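(* Let $r\ge1$. For any $c\in\mathcal{W}_r$ and any word $\mathbf{i}=i_1\cdots i_r\in\{1,\dots,r\}^r$ such that $\mathrm{cont}(\mathbf{i})=c$, we have $$A_c(q)=\sum_{T\in\mathcal{P}(\mathbf{i})}(r)_q!\;\mathrm{wt}(T,\mathbf{i}).$$
   Context: $\mathcal{W}_r$ is the set of sequences $(c_1,\dots,c_r)$ of nonnegative integers with $c_1+\cdots+c_r=r$. Write $(n)_q=1+q+\cdots+q^{n-1}$ and $(n)_q!=\prod_{1\le i\le n}(i)_q$. For $\mathbf{i}\in\{1,\dots,r\}^r$, $\mathrm{cont}(\mathbf{i})=(c_1,\dots,c_r)$ where $c_j$ is the number of occurrences of $j$ in $\mathbf{i}$. Definition of $A_c(q)$. Let $\mathbb{S}_{r+1}$ act on $\mathbb{C}[q,x_1,\dots,x_{r+1}]$ by permuting the indices of the $x_i$, and set $$\partial_{w_o}(f)=\frac{1}{\prod_{1\le i<j\le r+1}(x_i-x_j)}\sum_{\sigma\in\mathbb{S}_{r+1}}\epsilon(\sigma)\sigma(f),$$ with $\epsilon(\sigma)$ the sign of $\sigma$. Put $\langle f\rangle^q_{r+1}=\partial_{w_o}\bigl(f\prod_{1\le i<j-1\le r}(qx_i-x_j)\bigr)$ (product over pairs $(i,j)$ with $1\le i$, $i<j-1$, $j\le r+1$). If $f$ is homogeneous of degree $r$ in the $x_i$, then $\langle f\rangle^q_{r+1}\in\mathbb{C}[q]$. For $c\in\mathcal{W}_r$ the remixed Eulerian number is $$A_c(q)=\bigl\langle x_1^{c_1}(x_1+x_2)^{c_2}\cdots(x_1+\cdots+x_r)^{c_r}\bigr\rangle^q_{r+1}\in\mathbb{C}[q].$$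 Trees and weights. Let $T$ be a binary tree with $r$ nodes (each node has a possibly empty left subtree and a possibly empty right subtree). Its binary search labeling labels the nodes bijectively by $\{1,\dots,r\}$ in in-order (recursively: left subtree, then root, then right subtree); $bs(v)$ denotes the label of node $v$. For a node $v$, the set of labels $bs(w)$, for $w$ ranging over $v$ and all its descendants, is an interval, denoted $[l_v,r_v]$. A coloring $f:\mathrm{Nodes}(T)\to\mathbb{Z}$ is compatible if $f(v)\in[l_v,r_v]$ for all $v$, and then $$\mathrm{wt}(T,f)=\prod_{v\in T}\mathrm{wt}_q([l_v,r_v],bs(v),f(v)),$$ where for integers $a\le b$ and $i,j\in[a,b]$, $$\mathrm{wt}_q([a,b],j,i)=\begin{cases}\dfrac{(b-i+1)_q}{(b-j+1)_q}\,q^{i-j}& \text{if } i>j,\\[2mm] \dfrac{(i-a+1)_q}{(j-a+1)_q}& \text{if } i\le j.\end{cases}$$ A decreasing labeling of $T$ is a bijection $\mathrm{dec}$ from the nodes to $\{1,\dots,r\}$ such that the label of each node is larger than the labels of all its proper descendants. Given $\mathbf{i}=i_1\cdots i_r\in\{1,\dots,r\}^r$, the tree $T$ is $\mathbf{i}$-compatible if it has a (necessarily unique) decreasing labeling $\mathrm{dec}$ such that the coloring $v\mapsto i_{\mathrm{dec}(v)}$ is compatible; $\mathrm{wt}(T,\mathbf{i})$ is then the weight of this compatible coloring. $\mathcal{P}(\mathbf{i})$ is the set of $\mathbf{i}$-compatible binary trees with $r$ nodes. *)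

theory Defs
  imports
    "HOL-Library.Poly_Mapping"
    "HOL-Library.Tree"
    "HOL-Library.Sublist"
    "HOL-Library.FuncSet"
    "HOL-Combinatorics.Permutations"
    "HOL-Computational_Algebra.Polynomial_Factorial"
    Complex_Main
begin

definition words :: "nat \<Rightarrow> nat list set" where
  "words r = {w. length w = r \<and> set w \<subseteq> {1..r}}"

definition W :: "nat \<Rightarrow> nat list set" where
  "W r = {c. length c = r \<and> sum_list c = r}"

definition cont :: "nat list \<Rightarrow> nat list" where
  "cont w = map (\<lambda>j. count_list w j) [1..<length w + 1]"

section \<open>Remixed Eulerian numbers\<close>

text \<open>\<open>\<complex>[q, x\<^sub>1, x\<^sub>2, \<dots>]\<close> as polynomials in the \<open>x\<^sub>i\<close> with coefficients in \<open>\<complex>[q]\<close>.\<close>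

type_synonym mp = "(nat \<Rightarrow>\<^sub>0 nat) \<Rightarrow>\<^sub>0 complex poly"

definition X :: "nat \<Rightarrow> mp" where
  "X i = Poly_Mapping.single (Poly_Mapping.single i 1) 1"

definition C :: "complex poly \<Rightarrow> mp" where
  "C a = Poly_Mapping.single 0 a"

definition Q :: mp where
  "Q = C [:0, 1:]"

text \<open>The substitution \<open>x\<^sub>i \<mapsto> x\<^bsub>\<sigma> i\<^esub>\<close>, for a permutation \<open>\<sigma>\<close>: the coefficient of \<open>act \<sigma> f\<close> at the
  monomial \<open>\<Prod> x\<^sub>i ^ m\<^sub>i\<close> is that of \<open>f\<close> at the monomial with exponents \<open>m\<^bsub>\<sigma> i\<^esub>\<close>.\<close>

definition act :: "(nat \<Rightarrow> nat) \<Rightarrow> mp \<Rightarrow> mp" where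
  "act \<sigma> f = Poly_Mapping.map_key (Poly_Mapping.map_key \<sigma>) f"

lemma inj_map_key: "bij \<sigma> \<Longrightarrow> inj (Poly_Mapping.map_key \<sigma> :: (nat \<Rightarrow>\<^sub>0 nat) \<Rightarrow> _)"
proof (rule injI)
  fix m n :: "nat \<Rightarrow>\<^sub>0 nat"
  assume s: "bij \<sigma>" and e: "Poly_Mapping.map_key \<sigma> m = Poly_Mapping.map_key \<sigma> n"
  have "Poly_Mapping.lookup m (\<sigma> i) = Poly_Mapping.lookup n (\<sigma> i)" for i
    using arg_cong[OF e, of "\<lambda>p. Poly_Mapping.lookup p i"] s by (simp add: map_key.rep_eq bij_is_inj)
  then show "m = n"
    using s by (intro poly_mapping_eqI) (metis bij_pointE)
qed

lemma act_X: "bij \<sigma> \<Longrightarrow> act \<sigma> (X i) = X (\<sigma> i)"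
proof -
  assume s: "bij \<sigma>"
  have "Poly_Mapping.single i (1::nat) = Poly_Mapping.map_key \<sigma> (Poly_Mapping.single (\<sigma> i) 1)"
    using s by (simp add: map_key_single bij_is_inj)
  then show ?thesis
    unfolding act_def X_def using map_key_single[OF inj_map_key[OF s]] by simp
qed

text \<open>The ring \<open>mp\<close> is an integral domain, so the quotient by the Vandermonde product is unique
  when it exists.\<close>

definition divdiff :: "nat \<Rightarrow> mp \<Rightarrow> mp" where
  "divdiff r f = (THE g. (\<Prod>i=1..r+1. \<Prod>j=i+1..r+1. X i - X j) * g =
     (\<Sum>\<sigma> | \<sigma> permutes {1..r+1}. of_int (sign \<sigma>) * act \<sigma> f))"

definition qbracket :: "nat \<Rightarrow> mp \<Rightarrow> mp" where
  "qbracket r f = divdiff r (f * (\<Prod>i=1..r+1. \<Prod>j=i+2..r+1. Q * X i - X j))"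

text \<open>The bracket has degree \<open>0\<close> in the \<open>x\<^sub>i\<close>; \<open>A c\<close> is the corresponding element of \<open>\<complex>[q]\<close>.\<close>

definition A :: "nat list \<Rightarrow> complex poly" where
  "A c = (THE a. C a = qbracket (length c) (\<Prod>k=1..length c. (\<Sum>i=1..k. X i) ^ (c ! (k - 1))))"

section \<open>\<open>q\<close>-integers and elementary weights in \<open>\<complex>(q)\<close>\<close>

definition q :: "complex poly fract" where
  "q = to_fract [:0, 1:]"

definition qint :: "nat \<Rightarrow> complex poly fract" where
  "qint n = (\<Sum>k<n. q ^ k)"

definition qfact :: "nat \<Rightarrow> complex poly fract" where
  "qfact n = (\<Prod>i=1..n. qint i)"

definition wtq :: "int \<Rightarrow> int \<Rightarrow> int \<Rightarrow> int \<Rightarrow> complex poly fract" where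
  "wtq a b j i =
     (if i > j then qint (nat (b - i + 1)) / qint (nat (b - j + 1)) * q ^ nat (i - j)
      else qint (nat (i - a + 1)) / qint (nat (j - a + 1)))"

section \<open>Binary trees\<close>

text \<open>Binary trees are of type \<open>unit tree\<close>; a node is the path leading to it from the root
  (\<open>False\<close> is left, \<open>True\<close> is right), so the descendants of \<open>v\<close> are the nodes extending \<open>v\<close>.\<close>

type_synonym node = "bool list"

fun nodes :: "'a tree \<Rightarrow> node set" where
  "nodes Leaf = {}"
| "nodes (Node l x r) = insert [] ((#) False ` nodes l \<union> (#) True ` nodes r)"

text \<open>In-order label of a node; the value off \<open>nodes T\<close> is irrelevant.\<close>

fun bs :: "'a tree \<Rightarrow> node \<Rightarrow> int" where
  "bs Leaf v = 0"
| "bs (Node l x r) [] = int (size l) + 1"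
| "bs (Node l x r) (False # v) = bs l v"
| "bs (Node l x r) (True # v) = int (size l) + 1 + bs r v"

definition labels_below :: "'a tree \<Rightarrow> node \<Rightarrow> int set" where
  "labels_below T v = bs T ` {w \<in> nodes T. prefix v w}"

definition lo :: "'a tree \<Rightarrow> node \<Rightarrow> int" where
  "lo T v = Min (labels_below T v)"

definition hi :: "'a tree \<Rightarrow> node \<Rightarrow> int" where
  "hi T v = Max (labels_below T v)"

definition compatible :: "'a tree \<Rightarrow> (node \<Rightarrow> int) \<Rightarrow> bool" where
  "compatible T f \<longleftrightarrow> (\<forall>v\<in>nodes T. f v \<in> {lo T v..hi T v})"

definition wt :: "'a tree \<Rightarrow> (node \<Rightarrow> int) \<Rightarrow> complex poly fract" where
  "wt T f = (\<Prod>v\<in>nodes T. wtq (lo T v) (hi T v) (bs T v) (f v))"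

text \<open>Extensionality makes a labeling a function on the nodes only.\<close>

definition decreasing :: "'a tree \<Rightarrow> (node \<Rightarrow> nat) \<Rightarrow> bool" where
  "decreasing T dec \<longleftrightarrow> dec \<in> extensional (nodes T) \<and> bij_betw dec (nodes T) {1..size T} \<and>
     (\<forall>v\<in>nodes T. \<forall>w\<in>nodes T. strict_prefix v w \<longrightarrow> dec w < dec v)"

definition word_coloring :: "nat list \<Rightarrow> (node \<Rightarrow> nat) \<Rightarrow> node \<Rightarrow> int" where
  "word_coloring w dec v = int (w ! (dec v - 1))"

definition compatible_labeling :: "nat list \<Rightarrow> 'a tree \<Rightarrow> (node \<Rightarrow> nat) \<Rightarrow> bool" where
  "compatible_labeling w T dec \<longleftrightarrow> decreasing T dec \<and> compatible T (word_coloring w dec)"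

definition compatible_trees :: "nat list \<Rightarrow> unit tree set" where
  "compatible_trees w = {T. size T = length w \<and> (\<exists>dec. compatible_labeling w T dec)}"

definition wt_word :: "'a tree \<Rightarrow> nat list \<Rightarrow> complex poly fract" where
  "wt_word T w = wt T (word_coloring w (THE dec. compatible_labeling w T dec))"

end

theory Submission
  imports Defs "HOL-Library.Multiset"
begin

text \<open>
  Write \<open>y\<^sub>k = x\<^sub>1 + \<dots> + x\<^sub>k\<close>, and let \<open>A(M)\<close> be the bracket of the product of the \<open>y\<^sub>k\<close> over a
  multiset \<open>M\<close> of letters; the remixed Eulerian number of a word is \<open>A\<close> of its multiset of letters.
  Two properties of \<open>A\<close> suffice for the theorem.

  The first is the quadratic relation
  \<open>(1 + q) A(M + {i,i}) = q A(M + {i,i-1}) + A(M + {i,i+1})\<close>, where \<open>A\<close> vanishes as soon as a letter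
  \<open>0\<close> or \<open>r+1\<close> occurs (\<open>A_mset_relation\<close>). The two sides differ by the bracket of
  \<open>y\<^sub>i (q x\<^sub>i - x\<^bsub>i+1\<^esub>) m\<close> with \<open>m\<close> a monomial of degree \<open>r - 2\<close> in the \<open>y\<^sub>k\<close>. The factor
  \<open>q x\<^sub>i - x\<^bsub>i+1\<^esub>\<close> supplies the one adjacent pair that is missing among the pairs \<open>a \<le> i < b\<close>, so
  that the product over these pairs becomes symmetric in each of the blocks \<open>x\<^sub>1, \<dots>, x\<^sub>i\<close> and
  \<open>x\<^bsub>i+1\<^esub>, \<dots>, x\<^bsub>r+1\<^esub>\<close>. Antisymmetrization kills every polynomial whose degree in a block, taken
  over coefficients symmetric in that block, is less than \<open>0 + 1 + \<dots> + (b - 1)\<close> for a block of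
  size \<open>b\<close>: each of its monomials has two equal exponents (\<open>anti_eq_0_if_symdeg\<close>). A monomial of
  degree \<open>r - 2\<close> is too small to reach this bound in both blocks.

  The second is the normalization \<open>A({1,\<dots>,1}) = 1\<close> (\<open>A_mset_replicate\<close>). By the same vanishing
  principle every factor \<open>q x\<^sub>i - x\<^sub>j\<close> in the bracket of \<open>x\<^sub>1\<close> to the power \<open>r\<close> may be replaced by
  \<open>- x\<^sub>j\<close>, and what remains is a leading term of the Vandermonde product; the antisymmetrization of
  this term is the Vandermonde product itself.

  Now read a word letter by letter and keep the set \<open>I\<close> of occupied places. A letter \<open>i\<close> that falls
  into a component \<open>[a,b]\<close> of \<open>I\<close> performs, by the quadratic relations, a random walk with weights
  \<open>q\<close> to the left and \<open>1\<close> to the right, until it occupies \<open>a - 1\<close> or \<open>b + 1\<close>. The gambler's ruin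
  probabilities are exactly the elementary weights of the theorem. Hence \<open>A\<close> of a word is
  \<open>A({1,\<dots>,r})\<close> times the probability \<open>fill\<close> that the walk fills \<open>{1,\<dots>,r}\<close> (\<open>klyachko.eq_fill\<close>);
  for the word \<open>1\<dots>1\<close> this probability is the inverse of the \<open>q\<close>-factorial of \<open>r\<close>, which gives
  \<open>A({1,\<dots>,r})\<close>. Finally, if the last letter lands at \<open>j\<close>, the earlier letters have filled
  \<open>{1,\<dots>,j-1}\<close> and \<open>{j+1,\<dots>,r}\<close> independently (\<open>fill_interval_Cons\<close>). This is the recursion of a
  binary tree whose root has in-order label \<open>j\<close> and the largest decreasing label
  (\<open>tree_sum_rec\<close>), so that the probability is the sum of the weights of the compatible trees.
\<close>

section \<open>Permutations acting on polynomials\<close>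

lemma lookup_act:
  assumes "bij \<sigma>"
  shows "Poly_Mapping.lookup (act \<sigma> f) m = Poly_Mapping.lookup f (Poly_Mapping.map_key \<sigma> m)"
  using inj_map_key[OF assms] by (simp add: act_def map_key.rep_eq)

lemma act_add: "bij \<sigma> \<Longrightarrow> act \<sigma> (f + g) = act \<sigma> f + act \<sigma> g"
  by (rule poly_mapping_eqI) (simp add: lookup_act lookup_add)

lemma act_diff: "bij \<sigma> \<Longrightarrow> act \<sigma> (f - g) = act \<sigma> f - act \<sigma> g"
  by (rule poly_mapping_eqI) (simp add: lookup_act lookup_minus)

lemma act_0: "bij \<sigma> \<Longrightarrow> act \<sigma> 0 = 0"
  by (rule poly_mapping_eqI) (simp add: lookup_act)

lemma act_sum: "bij \<sigma> \<Longrightarrow> act \<sigma> (\<Sum>i\<in>I. f i) = (\<Sum>i\<in>I. act \<sigma> (f i))"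
  by (induction I rule: infinite_finite_induct) (simp_all add: act_0 act_add)

lemma act_comp:
  assumes "bij \<sigma>" "bij \<tau>"
  shows "act \<sigma> (act \<tau> f) = act (\<sigma> \<circ> \<tau>) f"
  using assms
  by (intro poly_mapping_eqI)
     (simp add: lookup_act map_key_compose bij_is_inj bij_comp)

lemma act_id: "act id f = f"
  by (rule poly_mapping_eqI, subst lookup_act[OF bij_id]) (simp add: map_key_id id_def)

lemma act_single:
  assumes "bij \<sigma>"
  shows "act \<sigma> (Poly_Mapping.single m a) = Poly_Mapping.single (Poly_Mapping.map_key (inv \<sigma>) m) a"
proof -
  have "m = Poly_Mapping.map_key \<sigma> (Poly_Mapping.map_key (inv \<sigma>) m)"
    using assms by (simp add: map_key_compose bij_is_inj bij_imp_bij_inv map_key_id id_def[symmetric])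
       (simp add: map_key_id id_def)
  then show ?thesis
    unfolding act_def using map_key_single[OF inj_map_key[OF assms]] by metis
qed

lemma sum_of_singles:
  fixes f :: mp
  shows "f = (\<Sum>m\<in>Poly_Mapping.keys f. Poly_Mapping.single m (Poly_Mapping.lookup f m))"
  by (rule poly_mapping_eqI)
     (auto simp: lookup_sum lookup_single when_def in_keys_iff sum.delta)

lemma act_mult:
  assumes "bij \<sigma>"
  shows "act \<sigma> (f * g) = act \<sigma> f * act \<sigma> g"
proof -
  have mk: "Poly_Mapping.map_key (inv \<sigma>) (m + m') =
      Poly_Mapping.map_key (inv \<sigma>) m + Poly_Mapping.map_key (inv \<sigma>) m'" for m m' :: "nat \<Rightarrow>\<^sub>0 nat"
    using assms by (simp add: map_key_plus bij_is_inj bij_imp_bij_inv)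
  define F where "F = (\<lambda>m. Poly_Mapping.single m (Poly_Mapping.lookup f m))"
  define G where "G = (\<lambda>m. Poly_Mapping.single m (Poly_Mapping.lookup g m))"
  have f: "f = (\<Sum>m\<in>Poly_Mapping.keys f. F m)" and g: "g = (\<Sum>m\<in>Poly_Mapping.keys g. G m)"
    unfolding F_def G_def by (rule sum_of_singles)+
  have *: "act \<sigma> (F m * G m') = act \<sigma> (F m) * act \<sigma> (G m')" for m m'
    using assms by (simp add: F_def G_def mult_single act_single mk)
  have "act \<sigma> (f * g) = act \<sigma> ((\<Sum>m\<in>Poly_Mapping.keys f. F m) * (\<Sum>m\<in>Poly_Mapping.keys g. G m))"
    using f g by metis
  also have "\<dots> = act \<sigma> (\<Sum>m\<in>Poly_Mapping.keys f. F m) * act \<sigma> (\<Sum>m\<in>Poly_Mapping.keys g. G m)"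
    by (simp add: sum_product act_sum[OF assms] *)
  finally show ?thesis
    using f g by metis
qed

lemma act_C: "bij \<sigma> \<Longrightarrow> act \<sigma> (C a) = C a"
  by (simp add: C_def act_single bij_is_inj bij_imp_bij_inv)

lemma act_1: "bij \<sigma> \<Longrightarrow> act \<sigma> 1 = 1"
  using act_C[of \<sigma> 1] by (simp add: C_def)

lemma act_prod: "bij \<sigma> \<Longrightarrow> act \<sigma> (\<Prod>i\<in>I. f i) = (\<Prod>i\<in>I. act \<sigma> (f i))"
  by (induction I rule: infinite_finite_induct) (simp_all add: act_1 act_mult)

lemma act_power: "bij \<sigma> \<Longrightarrow> act \<sigma> (f ^ k) = act \<sigma> f ^ k"
  by (induction k) (simp_all add: act_1 act_mult)

lemma C_add: "C (a + b) = C a + C b" and C_diff: "C (a - b) = C a - C b"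
  and C_mult: "C (a * b) = C a * C b" and C_0: "C 0 = 0" and C_1: "C 1 = 1"
  by (simp_all add: C_def single_add single_diff mult_single)

lemma C_of_int: "C (of_int k) = of_int k"
  by (simp add: C_def)

lemma C_eq_iff: "C a = C b \<longleftrightarrow> a = b"
  unfolding C_def by (metis lookup_single_eq)

lemma act_of_int: "bij \<sigma> \<Longrightarrow> act \<sigma> (of_int k) = of_int k"
  using act_C[of \<sigma> "of_int k"] by (simp add: C_of_int)

lemma act_Q: "bij \<sigma> \<Longrightarrow> act \<sigma> Q = Q"
  by (simp add: Q_def act_C)

section \<open>Antisymmetrization\<close>

definition anti :: "nat \<Rightarrow> mp \<Rightarrow> mp" where
  "anti n f = (\<Sum>\<sigma> | \<sigma> permutes {1..n}. of_int (sign \<sigma>) * act \<sigma> f)"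

lemma anti_add: "anti n (f + g) = anti n f + anti n g"
  by (simp add: anti_def act_add permutes_bij distrib_left sum.distrib)

lemma anti_diff: "anti n (f - g) = anti n f - anti n g"
  by (simp add: anti_def act_diff permutes_bij right_diff_distrib sum_subtractf)

lemma anti_0: "anti n 0 = 0"
  by (simp add: anti_def act_0 permutes_bij)

lemma anti_sum: "anti n (\<Sum>i\<in>I. f i) = (\<Sum>i\<in>I. anti n (f i))"
  by (induction I rule: infinite_finite_induct) (simp_all add: anti_0 anti_add)

lemma anti_C_mult: "anti n (C a * f) = C a * anti n f"
  by (simp add: anti_def act_mult act_C permutes_bij sum_distrib_left mult.left_commute)

lemma anti_act:
  assumes "\<tau> permutes {1..n}"
  shows "anti n (act \<tau> f) = of_int (sign \<tau>) * anti n f"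
proof -
  have "of_int (sign \<sigma>) * act \<sigma> (act \<tau> f) =
      of_int (sign \<tau>) * (of_int (sign (\<sigma> \<circ> \<tau>)) * act (\<sigma> \<circ> \<tau>) f)" if "\<sigma> permutes {1..n}" for \<sigma>
  proof -
    have "sign (\<sigma> \<circ> \<tau>) = sign \<sigma> * sign \<tau>"
      using that assms by (metis finite_atLeastAtMost permutes_imp_permutation sign_compose)
    moreover have "(of_int (sign \<tau>) * of_int (sign \<tau>) :: mp) = 1"
      by (metis of_int_1 of_int_mult sign_idempotent)
    ultimately show ?thesis
      using that assms by (simp add: act_comp permutes_bij algebra_simps)
  qed
  then have "anti n (act \<tau> f) =
      (\<Sum>\<sigma> | \<sigma> permutes {1..n}. of_int (sign \<tau>) * (of_int (sign (\<sigma> \<circ> \<tau>)) * act (\<sigma> \<circ> \<tau>) f))"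
    unfolding anti_def by (intro sum.cong) auto
  also have "\<dots> = of_int (sign \<tau>) * anti n f"
    unfolding anti_def sum_distrib_left by (rule sum_permutations_compose_right[OF assms, symmetric])
  finally show ?thesis .
qed

text \<open>The transposition negates the antisymmetrization, which is therefore its own negative; the
  characteristic is \<open>0\<close>.\<close>

lemma anti_eq_0_if_transpose_fixes:
  assumes "a \<in> {1..n}" "b \<in> {1..n}" "a \<noteq> b" "act (transpose a b) f = f"
  shows "anti n f = 0"
proof -
  have "anti n f = - anti n f"
    using anti_act[of "transpose a b" n f] assms by (simp add: permutes_swap_id sign_swap_id)
  then show ?thesis
    by (metis eq_neg_iff_add_eq_0 mult_2 mult_eq_0_iff zero_neq_numeral)
qed

section \<open>Vanishing of antisymmetrizations of small degree\<close>

text \<open>Transpositions generate the permutations of a finite set, so this is invariance under all finite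
  permutations of the variables \<open>x\<^sub>i\<close> with \<open>i \<in> B\<close>.\<close>

definition symm :: "nat set \<Rightarrow> mp \<Rightarrow> bool" where
  "symm B s \<longleftrightarrow> (\<forall>a\<in>B. \<forall>b\<in>B. act (transpose a b) s = s)"

lemma symmI: "(\<And>a b. a \<in> B \<Longrightarrow> b \<in> B \<Longrightarrow> act (transpose a b) s = s) \<Longrightarrow> symm B s"
  by (simp add: symm_def)

lemma symm_mult: "symm B s \<Longrightarrow> symm B t \<Longrightarrow> symm B (s * t)"
  by (simp add: symm_def act_mult)

lemma symm_diff: "symm B s \<Longrightarrow> symm B t \<Longrightarrow> symm B (s - t)"
  by (simp add: symm_def act_diff)

lemma symm_add: "symm B s \<Longrightarrow> symm B t \<Longrightarrow> symm B (s + t)"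
  by (simp add: symm_def act_add)

lemma symm_C: "symm B (C a)" and symm_1: "symm B 1" and symm_0: "symm B 0" and symm_Q: "symm B Q"
  by (simp_all add: symm_def act_C act_1 act_0 act_Q)

lemma symm_prod: "(\<And>i. i \<in> I \<Longrightarrow> symm B (f i)) \<Longrightarrow> symm B (\<Prod>i\<in>I. f i)"
  by (induction I rule: infinite_finite_induct) (simp_all add: symm_1 symm_mult)

lemma symm_sum: "(\<And>i. i \<in> I \<Longrightarrow> symm B (f i)) \<Longrightarrow> symm B (\<Sum>i\<in>I. f i)"
  by (induction I rule: infinite_finite_induct) (simp_all add: symm_0 symm_add)

lemma symm_power: "symm B s \<Longrightarrow> symm B (s ^ k)"
  by (simp add: symm_def act_power)

lemma symm_X: "i \<notin> B \<Longrightarrow> symm B (X i)"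
  by (rule symmI) (auto simp: act_X transpose_def)

text \<open>Degree at most \<open>d\<close> in the variables of \<open>B\<close>, over the ring of \<open>B\<close>-symmetric polynomials. The
  predicate is generated rather than read off the monomials of the expanded polynomial, because a
  coefficient such as \<open>x\<^sub>1 + \<dots> + x\<^sub>k\<close> with \<open>B \<subseteq> {1..k}\<close> contains variables of \<open>B\<close> and must count as
  having degree \<open>0\<close>.\<close>

inductive symdeg :: "nat set \<Rightarrow> nat \<Rightarrow> mp \<Rightarrow> bool" for B d where
  monom: "symm B s \<Longrightarrow> Poly_Mapping.keys m \<subseteq> B \<Longrightarrow> (\<Sum>i\<in>B. Poly_Mapping.lookup m i) \<le> d \<Longrightarrow>
    symdeg B d (s * Poly_Mapping.single m 1)"
| add: "symdeg B d f \<Longrightarrow> symdeg B d g \<Longrightarrow> symdeg B d (f + g)"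

lemma symdeg_symm: "symm B s \<Longrightarrow> symdeg B d s"
  using symdeg.monom[of B s 0 d] by simp

lemma symdeg_X:
  assumes "finite B" "i \<in> B"
  shows "symdeg B 1 (X i)"
proof -
  have "(\<Sum>j\<in>B. Poly_Mapping.lookup (Poly_Mapping.single i (1::nat)) j) = 1"
    using assms by (simp add: lookup_single when_def)
  then show ?thesis
    using symdeg.monom[of B 1 "Poly_Mapping.single i 1" 1] assms by (simp add: symm_1 X_def)
qed

lemma symdeg_mult:
  assumes "symdeg B d f" "symdeg B e g"
  shows "symdeg B (d + e) (f * g)"
  using assms(1)
proof (induction rule: symdeg.induct)
  case f: (monom s m)
  from assms(2) show ?case
  proof (induction rule: symdeg.induct)
    case g: (monom t k)
    have "s * Poly_Mapping.single m 1 * (t * Poly_Mapping.single k 1) =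
        s * t * (Poly_Mapping.single m 1 * Poly_Mapping.single k 1)"
      by (simp only: mult_ac)
    also have "\<dots> = s * t * Poly_Mapping.single (m + k) 1"
      by (simp only: mult_single mult_1)
    finally have "s * Poly_Mapping.single m 1 * (t * Poly_Mapping.single k 1) =
        s * t * Poly_Mapping.single (m + k) 1" .
    moreover have "Poly_Mapping.keys (m + k) \<subseteq> B"
      using Poly_Mapping.keys_add[of m k] f(2) g(2) by (meson Un_least order_trans)
    moreover have "(\<Sum>i\<in>B. Poly_Mapping.lookup (m + k) i) \<le> d + e"
      using f(3) g(3) by (simp add: lookup_add sum.distrib)
    ultimately show ?case
      using symdeg.monom[OF symm_mult[OF f(1) g(1)], of "m + k" "d + e"] by (simp only:)
  qed (simp add: distrib_left symdeg.add)
qed (simp add: distrib_right symdeg.add)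

lemma symdeg_mult_symm: "symm B s \<Longrightarrow> symdeg B d f \<Longrightarrow> symdeg B d (s * f)"
  using symdeg_mult[OF symdeg_symm, of B s d f 0] by simp

lemma symdeg_diff: "symdeg B d f \<Longrightarrow> symdeg B d g \<Longrightarrow> symdeg B d (f - g)"
  using symdeg.add[of B d f "C (-1) * g"] symdeg_mult_symm[OF symm_C, of B d g "-1"]
  by (simp add: C_def single_uminus)

lemma symdeg_sum: "(\<And>i. i \<in> I \<Longrightarrow> symdeg B d (f i)) \<Longrightarrow> symdeg B d (\<Sum>i\<in>I. f i)"
  by (induction I rule: infinite_finite_induct) (simp_all add: symdeg_symm symm_0 symdeg.add)

lemma symdeg_prod:
  "(\<And>i. i \<in> I \<Longrightarrow> symdeg B (d i) (f i)) \<Longrightarrow> symdeg B (\<Sum>i\<in>I. d i) (\<Prod>i\<in>I. f i)"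
  by (induction I rule: infinite_finite_induct) (simp_all add: symdeg_symm symm_1 symdeg_mult)

lemma symdeg_power: "symdeg B d f \<Longrightarrow> symdeg B (k * d) (f ^ k)"
  by (induction k) (simp_all add: symdeg_symm symm_1 symdeg_mult)

text \<open>The largest of \<open>k\<close> distinct natural numbers is at least \<open>k - 1\<close>; remove it and use induction.\<close>

lemma sum_distinct_nats_ge:
  fixes A :: "nat set"
  assumes "finite A"
  shows "(\<Sum>{..<card A}) \<le> \<Sum>A" and "\<Sum>A \<le> (\<Sum>{..<card A}) \<Longrightarrow> A = {..<card A}"
proof -
  have "(\<Sum>{..<card A}) \<le> \<Sum>A \<and> (\<Sum>A \<le> (\<Sum>{..<card A}) \<longrightarrow> A = {..<card A})"
    using assms
  proof (induction rule: finite_linorder_max_induct)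
    case (insert b A)
    have "A \<subseteq> {..<b}" using insert by auto
    then have "card A \<le> b" using card_mono[of "{..<b}" A] by simp
    moreover have "b \<notin> A" using insert by auto
    ultimately show ?case
      using insert by (auto simp: lessThan_Suc)
  qed simp
  then show "(\<Sum>{..<card A}) \<le> \<Sum>A" and "\<Sum>A \<le> (\<Sum>{..<card A}) \<Longrightarrow> A = {..<card A}" by blast+
qed

lemma act_transpose_single:
  assumes "Poly_Mapping.lookup m a = Poly_Mapping.lookup m b"
  shows "act (transpose a b) (Poly_Mapping.single m c) = Poly_Mapping.single m c"
proof -
  have "Poly_Mapping.map_key (transpose a b) m = m"
    by (rule poly_mapping_eqI) (auto simp: map_key.rep_eq transpose_def assms)
  then show ?thesis by (simp add: act_single)
qed

text \<open>The vanishing principle behind all computations with brackets. Distinct exponents on \<open>B\<close> would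
  have sum at least \<open>0 + 1 + \<dots> + (card B - 1)\<close>; hence each monomial has two equal exponents, and
  the corresponding transposition fixes the monomial as well as its symmetric coefficient.\<close>

lemma anti_eq_0_if_symdeg:
  assumes "symdeg B d f" "d < (\<Sum>{..<card B})" "B \<subseteq> {1..n}"
  shows "anti n f = 0"
  using assms(1)
proof (induction rule: symdeg.induct)
  case (monom s m)
  have fin: "finite B" using assms(3) finite_subset by blast
  have "\<not> inj_on (Poly_Mapping.lookup m) B"
  proof
    assume i: "inj_on (Poly_Mapping.lookup m) B"
    have "(\<Sum>{..<card B}) \<le> \<Sum>(Poly_Mapping.lookup m ` B)"
      using sum_distinct_nats_ge(1)[of "Poly_Mapping.lookup m ` B"] fin i by (simp add: card_image)
    then show False
      using monom(3) assms(2) i by (simp add: sum.reindex)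
  qed
  then obtain a b where ab: "a \<in> B" "b \<in> B" "a \<noteq> b" "Poly_Mapping.lookup m a = Poly_Mapping.lookup m b"
    by (auto simp: inj_on_def)
  have "act (transpose a b) (s * Poly_Mapping.single m 1) = s * Poly_Mapping.single m 1"
    using monom(1) ab by (simp add: act_mult act_transpose_single symm_def)
  then show ?case
    using ab assms(3) by (intro anti_eq_0_if_transpose_fixes[of a n b]) auto
qed (simp add: anti_add)

section \<open>The Vandermonde product\<close>

definition vand :: "nat \<Rightarrow> mp" where
  "vand n = (\<Prod>i=1..n. \<Prod>j=i+1..n. X i - X j)"

lemma vand_pairs: "vand n = (\<Prod>(i,j)\<in>(SIGMA i:{1..n}. {i+1..n}). X i - X j)"
  unfolding vand_def by (rule prod.Sigma) auto

text \<open>An adjacent transposition permutes the factors with \<open>i < j\<close>, except that it negates the factor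
  of the transposed pair itself.\<close>

lemma act_adjacent_vand:
  assumes "1 \<le> k" "k + 1 \<le> n"
  shows "act (transpose k (k+1)) (vand n) = - vand n"
proof -
  let ?\<tau> = "transpose k (k+1)" and ?S = "SIGMA i:{1..n}. {i+1..n}"
  let ?R = "?S - {(k,k+1)}"
  have S: "(k,k+1) \<in> ?S" "finite ?S" using assms by auto
  have "bij_betw (map_prod ?\<tau> ?\<tau>) ?R ?R"
    by (rule bij_betw_byWitness[where f' = "map_prod ?\<tau> ?\<tau>"])
       (use assms in \<open>auto simp: transpose_def split: if_splits\<close>)
  from prod.reindex_bij_betw[OF this, of "\<lambda>(i,j). X i - X j"]
  have R: "(\<Prod>(i,j)\<in>?R. X (?\<tau> i) - X (?\<tau> j)) = (\<Prod>(i,j)\<in>?R. X i - X j)"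
    by (simp add: case_prod_beta)
  have V: "vand n = (X k - X (k+1)) * (\<Prod>(i,j)\<in>?R. X i - X j)"
    unfolding vand_pairs by (subst prod.remove[OF S(2,1)]) simp
  have "act ?\<tau> (vand n) = (X (k+1) - X k) * (\<Prod>(i,j)\<in>?R. X (?\<tau> i) - X (?\<tau> j))"
    unfolding V by (simp add: act_mult act_prod act_diff act_X case_prod_beta)
  then show ?thesis
    unfolding R V by (simp add: algebra_simps)
qed

text \<open>A general transposition is a conjugate of an adjacent one by adjacent ones, hence its sign is that
  of an odd number of adjacent transpositions.\<close>

lemma act_transpose_vand:
  assumes "1 \<le> a" "a < b" "b \<le> n"
  shows "act (transpose a b) (vand n) = - vand n"
proof -
  have "Suc a \<le> b" using assms by simp
  then show ?thesis using assms(3)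
  proof (induction b rule: dec_induct)
    case base
    then show ?case using act_adjacent_vand[of a n] assms by simp
  next
    case (step b)
    let ?u = "transpose b (Suc b)"
    have u: "act ?u (vand n) = - vand n"
      using act_adjacent_vand[of b n] step assms by simp
    have neg: "act \<sigma> (- f) = - act \<sigma> f" if "bij \<sigma>" for \<sigma> f
      using act_diff[OF that, of 0 f] by (simp add: act_0 that)
    have "transpose a (Suc b) = ?u \<circ> (transpose a b \<circ> ?u)"
      using step by (auto simp: fun_eq_iff transpose_def)
    then have "act (transpose a (Suc b)) (vand n) = act ?u (act (transpose a b) (act ?u (vand n)))"
      by (simp add: act_comp bij_comp)
    also have "\<dots> = - vand n"
      using step by (simp add: u neg)
    finally show ?case .
  qed
qed

lemma act_vand:
  assumes "\<sigma> permutes {1..n}"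
  shows "act \<sigma> (vand n) = of_int (sign \<sigma>) * vand n"
  using assms finite_atLeastAtMost
proof (induction rule: permutes_induct)
  case id
  show ?case by (simp add: act_id[unfolded id_def])
next
  case (swap a b p)
  have "act (transpose a b) (vand n) = - vand n"
    using swap act_transpose_vand[of a b n] act_transpose_vand[of b a n]
    by (cases "a < b") (auto simp: transpose_commute)
  moreover have "sign (transpose a b \<circ> p) = - sign p"
    using swap by (simp add: sign_compose permutation_swap_id permutes_imp_permutation sign_swap_id
       permutes_imp_permutation[OF finite_atLeastAtMost])
  moreover have "act (transpose a b \<circ> p) (vand n) = act (transpose a b) (act p (vand n))"
    using swap act_comp[of "transpose a b" p "vand n"] by (simp add: permutes_bij)
  moreover have "act (transpose a b) (act p (vand n)) = of_int (sign p) * act (transpose a b) (vand n)"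
    using swap by (simp add: act_mult act_of_int)
  ultimately show ?case
    by (simp only: of_int_minus minus_mult_left mult_minus_right)
qed

lemma C_of_nat: "C (of_nat k) = of_nat k"
  by (simp add: C_def)

lemma C_sum: "C (\<Sum>i\<in>I. f i) = (\<Sum>i\<in>I. C (f i))"
  by (induction I rule: infinite_finite_induct) (simp_all add: C_0 C_add)

lemma anti_vand: "anti n (vand n) = C (of_nat (fact n)) * vand n"
proof -
  have "of_int (sign \<sigma>) * act \<sigma> (vand n) = vand n" if "\<sigma> permutes {1..n}" for \<sigma>
  proof -
    have "(of_int (sign \<sigma>) * of_int (sign \<sigma>) :: mp) = 1"
      by (metis of_int_1 of_int_mult sign_idempotent)
    then show ?thesis
      using that by (simp add: act_vand flip: mult.assoc)
  qed
  then have "anti n (vand n) = of_nat (card {\<sigma>. \<sigma> permutes {1..n}}) * vand n"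
    by (simp add: anti_def)
  moreover have "card {\<sigma>. \<sigma> permutes {1..n}} = fact n"
    by (simp add: card_permutations)
  ultimately show ?thesis
    by (simp only: C_of_nat)
qed

section \<open>Polynomials of bounded degree\<close>

definition deg_le :: "nat \<Rightarrow> nat \<Rightarrow> mp \<Rightarrow> bool" where
  "deg_le n d f \<longleftrightarrow> (\<forall>m\<in>Poly_Mapping.keys f. Poly_Mapping.keys m \<subseteq> {1..n} \<and>
     (\<Sum>i=1..n. Poly_Mapping.lookup m i) \<le> d)"

lemma deg_le_diff: "deg_le n d f \<Longrightarrow> deg_le n d g \<Longrightarrow> deg_le n d (f - g)"
  unfolding deg_le_def using Poly_Mapping.keys_diff[of f g] by blast

lemma deg_le_add: "deg_le n d f \<Longrightarrow> deg_le n d g \<Longrightarrow> deg_le n d (f + g)"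
  unfolding deg_le_def using Poly_Mapping.keys_add[of f g] by blast

lemma deg_le_C: "deg_le n d (C a)"
  by (simp add: deg_le_def C_def)

lemma deg_le_0: "deg_le n d 0"
  by (simp add: deg_le_def)

lemma deg_le_X:
  assumes "i \<in> {1..n}"
  shows "deg_le n 1 (X i)"
proof -
  have "(\<Sum>j=1..n. Poly_Mapping.lookup (Poly_Mapping.single i (1::nat)) j) = 1"
    using assms by (simp add: lookup_single when_def)
  then show ?thesis
    using assms by (simp add: deg_le_def X_def)
qed

lemma keys_multE:
  assumes "m \<in> Poly_Mapping.keys (f * g)"
  obtains k l where "m = k + l" "k \<in> Poly_Mapping.keys f" "l \<in> Poly_Mapping.keys g"
  using subsetD[OF Poly_Mapping.keys_mult assms] by blast

lemma deg_le_mult: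
  assumes "deg_le n d f" "deg_le n e g"
  shows "deg_le n (d + e) (f * g)"
  unfolding deg_le_def
proof
  fix m assume "m \<in> Poly_Mapping.keys (f * g)"
  then obtain k l where m: "m = k + l" "k \<in> Poly_Mapping.keys f" "l \<in> Poly_Mapping.keys g"
    by (rule keys_multE)
  then have "Poly_Mapping.keys k \<subseteq> {1..n}" "Poly_Mapping.keys l \<subseteq> {1..n}"
     "(\<Sum>i=1..n. Poly_Mapping.lookup k i) \<le> d" "(\<Sum>i=1..n. Poly_Mapping.lookup l i) \<le> e"
    using assms by (auto simp: deg_le_def)
  then show "Poly_Mapping.keys m \<subseteq> {1..n} \<and> (\<Sum>i=1..n. Poly_Mapping.lookup m i) \<le> d + e"
    unfolding m(1) using Poly_Mapping.keys_add[of k l]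
    by (simp add: lookup_add sum.distrib) (meson Un_least order_trans)
qed

lemma deg_le_C_mult: "deg_le n d f \<Longrightarrow> deg_le n d (C a * f)"
  using deg_le_mult[OF deg_le_C[of n 0 a]] by simp

lemma deg_le_sum: "(\<And>i. i \<in> I \<Longrightarrow> deg_le n d (f i)) \<Longrightarrow> deg_le n d (\<Sum>i\<in>I. f i)"
  by (induction I rule: infinite_finite_induct) (simp_all add: deg_le_0 deg_le_add)

lemma deg_le_1: "deg_le n d 1"
  using deg_le_C[of n d 1] by (simp add: C_1)

lemma deg_le_prod: "(\<And>i. i \<in> I \<Longrightarrow> deg_le n (d i) (f i)) \<Longrightarrow> deg_le n (\<Sum>i\<in>I. d i) (\<Prod>i\<in>I. f i)"
  by (induction I rule: infinite_finite_induct) (simp_all add: deg_le_1 deg_le_mult)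

lemma deg_le_power: "deg_le n d f \<Longrightarrow> deg_le n (k * d) (f ^ k)"
  by (induction k) (simp_all add: deg_le_1 deg_le_mult)

section \<open>Leading terms\<close>

text \<open>The term \<open>t\<close> strictly dominates the rest of \<open>f\<close> for the weight \<open>\<phi>\<close>. For an additive weight
  such terms multiply, which yields one coefficient of a product without expanding it.\<close>

definition lead :: "((nat \<Rightarrow>\<^sub>0 nat) \<Rightarrow> nat) \<Rightarrow> mp \<Rightarrow> mp \<Rightarrow> bool" where
  "lead \<phi> t f \<longleftrightarrow> (\<exists>m c. t = Poly_Mapping.single m c \<and> (\<forall>k\<in>Poly_Mapping.keys (f - t). \<phi> k < \<phi> m))"

lemma lead_mult:
  assumes add: "\<And>k l. \<phi> (k + l) = \<phi> k + \<phi> l" and "lead \<phi> t f" "lead \<phi> u g"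
  shows "lead \<phi> (t * u) (f * g)"
proof -
  obtain m c where t: "t = Poly_Mapping.single m c" "\<And>k. k \<in> Poly_Mapping.keys (f - t) \<Longrightarrow> \<phi> k < \<phi> m"
    using assms(2) by (auto simp: lead_def)
  obtain l d where u: "u = Poly_Mapping.single l d" "\<And>k. k \<in> Poly_Mapping.keys (g - u) \<Longrightarrow> \<phi> k < \<phi> l"
    using assms(3) by (auto simp: lead_def)
  have eq: "f * g - t * u = (f - t) * (g - u) + ((f - t) * u + t * (g - u))"
    by (simp add: algebra_simps)
  have "\<phi> k < \<phi> (m + l)" if "k \<in> Poly_Mapping.keys (f * g - t * u)" for k
  proof -
    have "k \<in> Poly_Mapping.keys ((f - t) * (g - u)) \<union> (Poly_Mapping.keys ((f - t) * u) \<union>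
        Poly_Mapping.keys (t * (g - u)))"
      using that Poly_Mapping.keys_add[of "(f - t) * (g - u)" "(f - t) * u + t * (g - u)"]
        Poly_Mapping.keys_add[of "(f - t) * u" "t * (g - u)"]
      unfolding eq by (meson Un_mono order_refl subsetD)
    then consider "k \<in> Poly_Mapping.keys ((f - t) * (g - u))" | "k \<in> Poly_Mapping.keys ((f - t) * u)"
      | "k \<in> Poly_Mapping.keys (t * (g - u))" by blast
    then show ?thesis
    proof cases
      case 1
      then obtain a b where "k = a + b" "a \<in> Poly_Mapping.keys (f - t)" "b \<in> Poly_Mapping.keys (g - u)"
        by (rule keys_multE)
      then show ?thesis using t(2) u(2) by (simp add: add add_strict_mono)
    next
      case 2
      then obtain a b where "k = a + b" "a \<in> Poly_Mapping.keys (f - t)" "b \<in> Poly_Mapping.keys u"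
        by (rule keys_multE)
      then show ?thesis using t(2) u(1) by (auto simp: add split: if_splits)
    next
      case 3
      then obtain a b where "k = a + b" "a \<in> Poly_Mapping.keys t" "b \<in> Poly_Mapping.keys (g - u)"
        by (rule keys_multE)
      then show ?thesis using t(1) u(2) by (auto simp: add split: if_splits)
    qed
  qed
  moreover have "t * u = Poly_Mapping.single (m + l) (c * d)"
    unfolding t(1) u(1) by (rule mult_single)
  ultimately show ?thesis
    unfolding lead_def by blast
qed

lemma lead_prod:
  assumes "\<And>k l. \<phi> (k + l) = \<phi> k + \<phi> l" and "\<And>i. i \<in> I \<Longrightarrow> lead \<phi> (t i) (f i)"
  shows "lead \<phi> (\<Prod>i\<in>I. t i) (\<Prod>i\<in>I. f i)"
proof -
  have "lead \<phi> 1 1"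
    unfolding lead_def by (rule exI[of _ 0], rule exI[of _ 1]) simp
  then show ?thesis
    using assms(2)
    by (induction I rule: infinite_finite_induct) (simp_all add: lead_mult[OF assms(1)])
qed

text \<open>The term of the Vandermonde product that selects \<open>x\<^sub>1\<close> from each factor \<open>x\<^sub>1 - x\<^sub>j\<close> and \<open>- x\<^sub>j\<close>
  from each factor \<open>x\<^sub>i - x\<^sub>j\<close> with \<open>1 < i < j\<close>, where the index \<open>i\<close> is shifted by one. In the form
  given here it is visibly the product of \<open>x\<^sub>1\<close> to the power \<open>r\<close> with the factors \<open>q x\<^sub>i - x\<^sub>j\<close> of
  the bracket at \<open>q = 0\<close>. The signs of the chosen factors make up its sign.\<close>

definition top_term :: "nat \<Rightarrow> mp" where
  "top_term r = X 1 ^ r * (\<Prod>i=1..r+1. \<Prod>j=i+2..r+1. - X j)"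

text \<open>Weights of the variables in the order \<open>x\<^sub>1 > x\<^sub>n > x\<^bsub>n-1\<^esub> > \<dots> > x\<^sub>2\<close>, for which the chosen entry
  of each factor of the Vandermonde product is the larger one.\<close>

definition top_weight :: "nat \<Rightarrow> (nat \<Rightarrow>\<^sub>0 nat) \<Rightarrow> nat" where
  "top_weight n m = (\<Sum>i=1..n. (if i = 1 then n + 1 else i) * Poly_Mapping.lookup m i)"

lemma lead_vand: "lead (top_weight (r+1)) (top_term r) (vand (r+1))"
proof -
  define t where "t = (\<lambda>i j::nat. if i = (1::nat) then X 1 else - X j)"
  have w1: "top_weight (r+1) (Poly_Mapping.single i 1) = (if i = 1 then r + 2 else i)" if "i \<in> {1..r+1}" for i
  proof -
    have "top_weight (r+1) (Poly_Mapping.single i 1) =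
        (\<Sum>j\<in>{1..r+1}. if j = i then (if i = 1 then r + 2 else i) else 0)"
      unfolding top_weight_def by (rule sum.cong) (auto simp: lookup_single when_def)
    then show ?thesis
      using that by simp
  qed
  have add: "top_weight (r+1) (k + l) = top_weight (r+1) k + top_weight (r+1) l" for k l
    by (simp add: top_weight_def lookup_add distrib_left sum.distrib)
  have "lead (top_weight (r+1)) (t i j) (X i - X j)" if "i \<in> {1..r+1}" "j \<in> {i+1..r+1}" for i j
  proof (cases "i = 1")
    case True
    then show ?thesis
      using that w1[of 1] w1[of j] unfolding lead_def t_def
      by (intro exI[of _ "Poly_Mapping.single 1 1"] exI[of _ 1])
         (auto simp: X_def simp flip: single_uminus)
  next
    case False
    then show ?thesis
      using that w1[of i] w1[of j] unfolding lead_def t_def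
      by (intro exI[of _ "Poly_Mapping.single j 1"] exI[of _ "- 1"])
         (auto simp: X_def single_uminus)
  qed
  then have "lead (top_weight (r+1)) (\<Prod>i=1..r+1. \<Prod>j=i+1..r+1. t i j) (vand (r+1))"
    unfolding vand_def by (intro lead_prod add) auto
  also have "(\<Prod>i=1..r+1. \<Prod>j=i+1..r+1. t i j) = top_term r"
  proof -
    have "(\<Prod>i=1..r+1. \<Prod>j=i+1..r+1. t i j) = X 1 ^ r * (\<Prod>i=Suc 1..Suc r. \<Prod>j=i+1..r+1. t i j)"
      by (subst prod.atLeast_Suc_atMost) (simp_all add: t_def)
    also have "(\<Prod>i=Suc 1..Suc r. \<Prod>j=i+1..r+1. t i j) = (\<Prod>i=1..r. \<Prod>j=i+2..r+1. - X j)"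
      unfolding prod.shift_bounds_cl_Suc_ivl by (intro prod.cong) (auto simp: t_def)
    finally show ?thesis
      by (simp add: top_term_def)
  qed
  finally show ?thesis .
qed

lemma prod_single:
  "finite I \<Longrightarrow> (\<Prod>i\<in>I. Poly_Mapping.single (m i) (c i)) = (Poly_Mapping.single (\<Sum>i\<in>I. m i) (\<Prod>i\<in>I. c i) :: mp)"
  by (induction I rule: finite_induct) (simp_all add: mult_single)

text \<open>The exponents of \<open>top_term\<close>: \<open>r, 0, 1, \<dots>, r - 1\<close> at the places \<open>1, 2, 3, \<dots>, r + 1\<close>.\<close>

definition top_exp :: "nat \<Rightarrow> nat \<Rightarrow>\<^sub>0 nat" where
  "top_exp r = Poly_Mapping.single 1 r + (\<Sum>i=1..r+1. \<Sum>j=i+2..r+1. Poly_Mapping.single j 1)"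

lemma top_term_single:
  obtains c where "top_term r = C c * Poly_Mapping.single (top_exp r) 1" "c * c = 1"
proof -
  define c where "c = (\<Prod>i=1..r+1. \<Prod>j=i+2..r+1. - 1 :: complex poly)"
  have X1: "X 1 ^ r = Poly_Mapping.single (Poly_Mapping.single 1 r) 1"
    by (induction r) (simp_all add: X_def mult_single flip: single_add)
  then have "top_term r = C c * Poly_Mapping.single (top_exp r) 1"
    unfolding top_term_def X1 c_def top_exp_def C_def unfolding X_def
    by (simp only: prod_single mult_single finite_atLeastAtMost add_0 mult_1 mult_1_right
        flip: single_uminus)
  moreover have "c * c = 1"
    unfolding c_def by (simp flip: prod.distrib power_mult_distrib)
  ultimately show thesis by (rule that)
qed

lemma lookup_top_exp:
  assumes "t \<in> {1..r+1}"
  shows "Poly_Mapping.lookup (top_exp r) t = (if t = 1 then r else t - 2)"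
proof -
  have "(\<Sum>j=i+2..r+1. Poly_Mapping.lookup (Poly_Mapping.single j (1::nat)) t) =
      (if i \<in> {i. i + 2 \<le> t} then 1 else 0)" for i
    using assms by (simp add: lookup_single when_def)
  then have "(\<Sum>i=1..r+1. \<Sum>j=i+2..r+1. Poly_Mapping.lookup (Poly_Mapping.single j (1::nat)) t) =
      (\<Sum>i=1..r+1. if i \<in> {i. i + 2 \<le> t} then 1 else 0)"
    by (simp only:)
  also have "\<dots> = card ({1..r+1} \<inter> {i. i + 2 \<le> t})"
    by (subst sum.If_cases) auto
  also have "{1..r+1} \<inter> {i. i + 2 \<le> t} = {1..t-2}"
    using assms by auto
  finally have *: "(\<Sum>i=1..r+1. \<Sum>j=i+2..r+1. Poly_Mapping.lookup (Poly_Mapping.single j (1::nat)) t) = t - 2"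
    by (simp only: card_atLeastAtMost diff_Suc_1)
  show ?thesis
    unfolding top_exp_def lookup_add lookup_sum * by (auto simp: lookup_single when_def)
qed

lemma lookup_top_exp_outside: "t \<notin> {1..r+1} \<Longrightarrow> Poly_Mapping.lookup (top_exp r) t = 0"
  by (auto simp: top_exp_def lookup_add lookup_sum lookup_single when_def)

lemma bij_betw_top_exp: "bij_betw (Poly_Mapping.lookup (top_exp r)) {1..r+1} {..<r+1}"
proof -
  have "bij_betw (\<lambda>t. if t = 1 then r else t - 2) {1..r+1} {..<r+1}"
    by (rule bij_betw_byWitness[where f' = "\<lambda>e. if e = r then 1 else e + 2"]) (auto split: if_splits)
  then show ?thesis
    using bij_betw_cong[of "{1..r+1}" "Poly_Mapping.lookup (top_exp r)"] by (simp add: lookup_top_exp)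
qed

text \<open>If the exponents are distinct, their sum forces them to be \<open>0, 1, \<dots>, r\<close> in some order, so that a
  permutation carries the monomial to \<open>top_exp\<close>; otherwise the antisymmetrization vanishes.\<close>

lemma anti_monom:
  assumes "Poly_Mapping.keys m \<subseteq> {1..r+1}" "(\<Sum>i=1..r+1. Poly_Mapping.lookup m i) \<le> \<Sum>{..<r+1}"
  shows "\<exists>e. anti (r+1) (Poly_Mapping.single m 1) = C e * anti (r+1) (Poly_Mapping.single (top_exp r) 1)"
proof (cases "inj_on (Poly_Mapping.lookup m) {1..r+1}")
  case False
  then obtain a b where "a \<in> {1..r+1}" "b \<in> {1..r+1}" "a \<noteq> b"
      "Poly_Mapping.lookup m a = Poly_Mapping.lookup m b"
    by (auto simp: inj_on_def)
  then have "anti (r+1) (Poly_Mapping.single m 1) = 0"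
    by (metis anti_eq_0_if_transpose_fixes act_transpose_single)
  then show ?thesis
    by (intro exI[of _ 0]) (simp add: C_0)
next
  case True
  let ?m = "Poly_Mapping.lookup m" and ?t = "Poly_Mapping.lookup (top_exp r)"
  have "?m ` {1..r+1} = {..<card (?m ` {1..r+1})}"
    using True assms(2) by (intro sum_distinct_nats_ge(2)) (simp_all add: sum.reindex card_image)
  then have m: "bij_betw ?m {1..r+1} {..<r+1}"
    using True by (simp add: bij_betw_def card_image)
  define \<sigma> where "\<sigma> = (\<lambda>i. if i \<in> {1..r+1} then inv_into {1..r+1} ?m (?t i) else i)"
  have "bij_betw (inv_into {1..r+1} ?m \<circ> ?t) {1..r+1} {1..r+1}"
    using bij_betw_top_exp bij_betw_inv_into[OF m] by (rule bij_betw_trans)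
  moreover have "bij_betw \<sigma> {1..r+1} {1..r+1} =
      bij_betw (inv_into {1..r+1} ?m \<circ> ?t) {1..r+1} {1..r+1}"
    by (rule bij_betw_cong) (simp add: \<sigma>_def)
  ultimately have "bij_betw \<sigma> {1..r+1} {1..r+1}"
    by simp
  then have \<sigma>: "\<sigma> permutes {1..r+1}"
    by (rule bij_imp_permutes) (auto simp: \<sigma>_def)
  have "Poly_Mapping.map_key \<sigma> m = top_exp r"
  proof (rule poly_mapping_eqI)
    fix i
    show "Poly_Mapping.lookup (Poly_Mapping.map_key \<sigma> m) i = ?t i"
    proof (cases "i \<in> {1..r+1}")
      case True
      then have "?t i \<in> ?m ` {1..r+1}"
        using bij_betw_top_exp[of r] m unfolding bij_betw_def by auto
      then show ?thesis
        using True \<sigma> by (simp add: map_key.rep_eq permutes_inj \<sigma>_def f_inv_into_f)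
    next
      case False
      then have "?m i = 0"
        using assms(1) by (auto simp: in_keys_iff)
      moreover have "\<sigma> i = i"
        using False by (auto simp: \<sigma>_def)
      ultimately show ?thesis
        using lookup_top_exp_outside[OF False] by (simp add: map_key.rep_eq permutes_inj[OF \<sigma>])
    qed
  qed
  then have "act (inv \<sigma>) (Poly_Mapping.single m 1) = Poly_Mapping.single (top_exp r) 1"
    using \<sigma> by (simp add: act_single permutes_bij bij_imp_bij_inv inv_inv_eq)
  then have "anti (r+1) (Poly_Mapping.single (top_exp r) 1) =
      of_int (sign (inv \<sigma>)) * anti (r+1) (Poly_Mapping.single m 1)"
    using anti_act[OF permutes_inv[OF \<sigma>], of "Poly_Mapping.single m 1"] by simp
  moreover have "(of_int (sign (inv \<sigma>)) * of_int (sign (inv \<sigma>)) :: mp) = 1"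
    by (metis of_int_1 of_int_mult sign_idempotent)
  ultimately have "anti (r+1) (Poly_Mapping.single m 1) =
      of_int (sign (inv \<sigma>)) * anti (r+1) (Poly_Mapping.single (top_exp r) 1)"
    by (simp flip: mult.assoc)
  then show ?thesis
    by (metis C_of_int)
qed

lemma anti_deg_le:
  assumes "deg_le (r+1) (\<Sum>{..<r+1}) f"
  shows "\<exists>e. anti (r+1) f = C e * anti (r+1) (Poly_Mapping.single (top_exp r) 1)"
proof -
  let ?E = "anti (r+1) (Poly_Mapping.single (top_exp r) 1)"
  have "\<forall>m\<in>Poly_Mapping.keys f. \<exists>e. anti (r+1) (Poly_Mapping.single m 1) = C e * ?E"
    using assms anti_monom by (auto simp: deg_le_def)
  then obtain e where e: "\<And>m. m \<in> Poly_Mapping.keys f \<Longrightarrow> anti (r+1) (Poly_Mapping.single m 1) = C (e m) * ?E"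
    by metis
  have s: "Poly_Mapping.single m a = C a * Poly_Mapping.single m 1" for m a
    by (simp add: C_def mult_single)
  have "anti (r+1) f = (\<Sum>m\<in>Poly_Mapping.keys f. C (Poly_Mapping.lookup f m) * (C (e m) * ?E))"
    using arg_cong[OF sum_of_singles[of f], of "anti (r+1)"]
    unfolding anti_sum s[of _ "Poly_Mapping.lookup _ _"] anti_C_mult by (simp only: e cong: sum.cong)
  also have "\<dots> = C (\<Sum>m\<in>Poly_Mapping.keys f. Poly_Mapping.lookup f m * e m) * ?E"
    by (simp add: C_sum C_mult sum_distrib_right mult.assoc)
  finally show ?thesis by blast
qed

lemma lookup_C_mult: "Poly_Mapping.lookup (C a * f) m = a * Poly_Mapping.lookup f m"
  by (simp add: C_def map.rep_eq when_def flip: mult_map_scale_conv_mult)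

text \<open>The number of pairs \<open>i, j\<close> with \<open>s \<le> i\<close> and \<open>i + 2 \<le> j \<le> n\<close>, counted by rows; row \<open>i = n\<close>
  is empty, as is row \<open>i = n - 1\<close>.\<close>

lemma sum_row_lengths:
  fixes s n :: nat
  assumes "s \<le> n"
  shows "(\<Sum>a=s..n. n - (a + 1)) = \<Sum>{..<n-s}"
  using assms
proof (induction s rule: inc_induct)
  case (step s)
  have "(\<Sum>a=s..n. n - (a + 1)) = n - (s + 1) + (\<Sum>a=Suc s..n. n - (a + 1))"
    using step by (simp add: sum.atLeast_Suc_atMost)
  also have "\<dots> = \<Sum>{..<Suc (n - Suc s)}"
    by (simp only: step.IH lessThan_Suc sum.insert finite_lessThan lessThan_iff less_irrefl) simp
  also have "Suc (n - Suc s) = n - s"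
    using step by simp
  finally show ?case .
qed simp

text \<open>The Vandermonde product is antisymmetric, so antisymmetrizing it multiplies it by a factorial. On
  the other hand its antisymmetrization is a multiple of that of the monomial \<open>top_exp\<close>. The factor
  between the two is found by comparing the coefficients at \<open>top_exp\<close>.\<close>

lemma vand_eq_anti_top_term: "vand (r+1) = anti (r+1) (top_term r)"
  and lookup_vand_top_exp: "Poly_Mapping.lookup (vand (r+1)) (top_exp r) \<noteq> 0"
proof -
  let ?E = "anti (r+1) (Poly_Mapping.single (top_exp r) 1)"
  obtain c where c: "top_term r = C c * Poly_Mapping.single (top_exp r) 1" "c * c = 1"
    by (rule top_term_single)
  have "c \<noteq> 0" using c(2) by auto
  have top_term': "top_term r = Poly_Mapping.single (top_exp r) c"
    by (simp add: c(1) C_def mult_single)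
  have V: "Poly_Mapping.lookup (vand (r+1)) (top_exp r) = c"
  proof -
    \<comment> \<open>All other terms have smaller weight, so \<open>top_exp\<close> occurs in \<open>top_term\<close> only.\<close>
    obtain m d where md: "Poly_Mapping.single (top_exp r) c = Poly_Mapping.single m d"
      "\<And>k. k \<in> Poly_Mapping.keys (vand (r+1) - top_term r) \<Longrightarrow> top_weight (r+1) k < top_weight (r+1) m"
      using lead_vand[of r] unfolding lead_def top_term' by auto
    have "m = top_exp r"
      using md(1) \<open>c \<noteq> 0\<close> by (metis lookup_single_eq lookup_single_not_eq)
    then have "top_exp r \<notin> Poly_Mapping.keys (vand (r+1) - top_term r)"
      using md(2) by blast
    then show ?thesis
      by (simp add: in_keys_iff lookup_minus top_term')
  qed
  then show "Poly_Mapping.lookup (vand (r+1)) (top_exp r) \<noteq> 0"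
    using \<open>c \<noteq> 0\<close> by simp
  have E: "Poly_Mapping.lookup ?E (top_exp r) = 1"
  proof -
    have "Poly_Mapping.lookup (of_int (sign \<sigma>) * act \<sigma> (Poly_Mapping.single (top_exp r) 1)) (top_exp r) =
        (if \<sigma> = id then 1 else 0)" if \<sigma>: "\<sigma> permutes {1..r+1}" for \<sigma>
    proof (cases "\<sigma> = id")
      case False
      then obtain i where i: "\<sigma> i \<noteq> i" by (auto simp: fun_eq_iff)
      then have "i \<in> {1..r+1}" "\<sigma> i \<in> {1..r+1}"
        using \<sigma> by (metis permutes_def, metis permutes_def permutes_in_image)
      then have "Poly_Mapping.lookup (top_exp r) (\<sigma> i) \<noteq> Poly_Mapping.lookup (top_exp r) i"
        using bij_betw_top_exp[of r] i by (auto simp: bij_betw_def inj_on_def)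
      then have "Poly_Mapping.map_key \<sigma> (top_exp r) \<noteq> top_exp r"
        using permutes_inj[OF \<sigma>] by (metis comp_apply map_key.rep_eq)
      then show ?thesis
        using False \<sigma> C_of_int[of "sign \<sigma>"]
        by (simp add: lookup_act permutes_bij lookup_single when_def lookup_C_mult flip: C_of_int)
    qed (simp add: act_id)
    then have "Poly_Mapping.lookup ?E (top_exp r) = (\<Sum>\<sigma> | \<sigma> permutes {1..r+1}. if \<sigma> = id then 1 else 0)"
      unfolding anti_def lookup_sum by (intro sum.cong) auto
    also have "\<dots> = 1"
      using finite_permutations[of "{1..r+1}"] by (subst sum.delta) (auto simp: permutes_id)
    finally show ?thesis .
  qed
  have "deg_le (r+1) (\<Sum>i=1..r+1. \<Sum>j=i+1..r+1. 1) (vand (r+1))"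
    unfolding vand_def by (intro deg_le_prod deg_le_diff deg_le_X) auto
  moreover have "(\<Sum>i=1..r+1. \<Sum>j=i+1..r+1. 1::nat) = \<Sum>{..<r+1}"
  proof -
    have "(\<Sum>i=1..r+1. \<Sum>j=i+1..r+1. 1::nat) = (\<Sum>a=1..r+1. (r+2) - (a+1))"
      by (intro sum.cong) auto
    also have "\<dots> = (\<Sum>a=1..r+2. (r+2) - (a+1))"
      by simp
    also have "\<dots> = \<Sum>{..<r+2-1}"
      by (rule sum_row_lengths) simp
    finally show ?thesis by simp
  qed
  ultimately obtain e where e: "C (of_nat (fact (r+1))) * vand (r+1) = C e * ?E"
    using anti_deg_le anti_vand by metis
  \<comment> \<open>Coefficients at \<open>top_exp\<close> on both sides.\<close>
  have ec: "of_nat (fact (r+1)) * c = e"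
    using arg_cong[OF e, of "\<lambda>f. Poly_Mapping.lookup f (top_exp r)"] V E by (simp only: lookup_C_mult mult_1_right)
  have "C (of_nat (fact (r+1))) * vand (r+1) = C (of_nat (fact (r+1))) * (C c * ?E)"
    using e unfolding ec[symmetric] C_mult mult.assoc .
  moreover have "C (of_nat (fact (r+1))) \<noteq> 0"
    unfolding C_of_nat of_nat_eq_0_iff by simp
  ultimately have "vand (r+1) = C c * ?E"
    by (simp only: mult_cancel_left) simp
  then show "vand (r+1) = anti (r+1) (top_term r)"
    by (simp only: c(1) anti_C_mult)
qed

lemma vand_nonzero: "vand (r+1) \<noteq> 0"
  using lookup_vand_top_exp[of r] by auto

text \<open>Existence of the quotient in the definition of the bracket, and its freeness of the \<open>x\<^sub>i\<close>.\<close>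

lemma anti_multiple_of_vand:
  assumes "deg_le (r+1) (\<Sum>{..<r+1}) f"
  shows "\<exists>a. anti (r+1) f = vand (r+1) * C a"
proof -
  let ?E = "anti (r+1) (Poly_Mapping.single (top_exp r) 1)"
  obtain e where e: "anti (r+1) f = C e * ?E"
    using anti_deg_le[OF assms] by blast
  obtain c where c: "top_term r = C c * Poly_Mapping.single (top_exp r) 1" "c * c = 1"
    by (rule top_term_single)
  have "vand (r+1) * C (c * e) = C (c * c) * (C e * ?E)"
    unfolding vand_eq_anti_top_term c(1) anti_C_mult C_mult by (simp only: ac_simps)
  then show ?thesis
    using e c(2) by (metis C_1 mult_1)
qed

section \<open>The bracket and remixed Eulerian numbers\<close>

definition xsum :: "nat \<Rightarrow> mp" where
  "xsum k = (\<Sum>i=1..k. X i)"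

definition qdiff :: "nat \<Rightarrow> nat \<Rightarrow> mp" where
  "qdiff i j = Q * X i - X j"

definition nonadj :: "nat \<Rightarrow> mp" where
  "nonadj r = (\<Prod>i=1..r+1. \<Prod>j=i+2..r+1. qdiff i j)"

text \<open>Both descriptions in the definition of \<open>A\<close> are unique: the Vandermonde product can be cancelled,
  and constants are determined by their embedding.\<close>

lemma A_eqI:
  assumes "anti (length c + 1) ((\<Prod>k=1..length c. xsum k ^ (c ! (k - 1))) * nonadj (length c)) =
    vand (length c + 1) * C a"
  shows "A c = a"
proof -
  have "(THE g. vand (length c + 1) * g = vand (length c + 1) * C a) = C a"
    using vand_nonzero by (intro the_equality) simp_all
  then have "qbracket (length c) (\<Prod>k=1..length c. (\<Sum>i=1..k. X i) ^ (c ! (k - 1))) = C a"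
    using assms unfolding qbracket_def divdiff_def anti_def vand_def nonadj_def qdiff_def xsum_def by simp
  then show ?thesis
    unfolding A_def by (intro the_equality) (simp_all only: C_eq_iff)
qed

subsection \<open>The bracket of a power of the first variable\<close>

text \<open>The parts of top degree in the \<open>x\<^sub>j\<close> agree, so the degree in \<open>B\<close> drops by one.\<close>

lemma prod_shift_diff_symdeg:
  assumes "finite J" "J \<noteq> {}" "finite B" "J \<subseteq> B" "symm B u"
  shows "symdeg B (card J - 1) ((\<Prod>j\<in>J. u - X j) - (\<Prod>j\<in>J. - X j))"
  using assms(1,2,4)
proof (induction rule: finite_ne_induct)
  case (singleton x)
  then show ?case using assms by (simp add: symdeg_symm)
next
  case (insert x J)
  have eq: "(\<Prod>j\<in>insert x J. u - X j) - (\<Prod>j\<in>insert x J. - X j) =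
      u * (\<Prod>j\<in>J. u - X j) - X x * ((\<Prod>j\<in>J. u - X j) - (\<Prod>j\<in>J. - X j))"
    using insert by (simp add: algebra_simps)
  have "symdeg B (\<Sum>j\<in>J. 1) (\<Prod>j\<in>J. u - X j)"
    using insert assms by (intro symdeg_prod symdeg_diff symdeg_X symdeg_symm) auto
  then have 1: "symdeg B (card J) (u * (\<Prod>j\<in>J. u - X j))"
    using assms by (simp add: symdeg_mult_symm)
  have "symdeg B (1 + (card J - 1)) (X x * ((\<Prod>j\<in>J. u - X j) - (\<Prod>j\<in>J. - X j)))"
    using insert assms by (intro symdeg_mult symdeg_X) auto
  moreover have "1 + (card J - 1) = card J"
    using insert by (cases "card J") auto
  ultimately have "symdeg B (card J) ((\<Prod>j\<in>insert x J. u - X j) - (\<Prod>j\<in>insert x J. - X j))"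
    unfolding eq using 1 by (metis symdeg_diff)
  then show ?case
    using insert by simp
qed

lemma symdeg_qdiff: "finite B \<Longrightarrow> i \<in> B \<Longrightarrow> j \<in> B \<Longrightarrow> symdeg B 1 (qdiff i j)"
  unfolding qdiff_def by (intro symdeg_diff symdeg_mult_symm symm_Q symdeg_X)

lemma symdeg_nonadj:
  assumes "1 \<le> s" "s \<le> n"
  shows "symdeg {s..n} (\<Sum>{..<n-s}) (\<Prod>i=s..n. \<Prod>j=i+2..n. qdiff i j)"
proof -
  have "symdeg {s..n} (\<Sum>i=s..n. \<Sum>j=i+2..n. 1) (\<Prod>i=s..n. \<Prod>j=i+2..n. qdiff i j)"
    by (intro symdeg_prod symdeg_qdiff) auto
  also have "(\<Sum>i=s..n. \<Sum>j=i+2..n. 1) = (\<Sum>a=s..n. n - (a + 1))"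
    by simp
  also have "\<dots> = \<Sum>{..<n-s}"
    by (rule sum_row_lengths[OF assms(2)])
  finally show ?thesis .
qed

lemma symm_prod_permuted:
  assumes "B \<subseteq> S" "\<And>a b i. a \<in> B \<Longrightarrow> b \<in> B \<Longrightarrow> i \<in> S \<Longrightarrow> act (transpose a b) (f i) = f (transpose a b i)"
  shows "symm B (\<Prod>i\<in>S. f i)"
proof (rule symmI)
  fix a b assume ab: "a \<in> B" "b \<in> B"
  then have p: "transpose a b permutes S"
    using assms(1) by (intro permutes_swap_id) auto
  have "act (transpose a b) (\<Prod>i\<in>S. f i) = (\<Prod>i\<in>S. f (transpose a b i))"
    unfolding act_prod[OF bij_transpose] using ab assms(2) by (intro prod.cong) auto
  also have "\<dots> = (\<Prod>i\<in>S. f i)"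
    using prod.permute[OF p, of f] by (simp add: comp_def)
  finally show "act (transpose a b) (\<Prod>i\<in>S. f i) = (\<Prod>i\<in>S. f i)" .
qed

text \<open>Setting \<open>q = 0\<close> in row \<open>k + 1\<close> of the product, the rows above having been treated already. The
  vanishing principle applies to the variables \<open>x\<^bsub>k+2\<^esub>, \<dots>, x\<^bsub>r+1\<^esub>\<close>: the treated rows contain all of
  them symmetrically, the remaining rows fall short of the required degree by exactly the degree of
  row \<open>k + 1\<close>, and the difference of the two versions of this row has smaller degree.\<close>

lemma anti_freeze_factor:
  assumes "k \<le> r"
  shows "anti (r+1) (X 1 ^ r * (\<Prod>i=1..k. \<Prod>j=i+2..r+1. - X j) * (\<Prod>i=k+1..r+1. \<Prod>j=i+2..r+1. qdiff i j)) =
    anti (r+1) (X 1 ^ r * (\<Prod>i=1..k+1. \<Prod>j=i+2..r+1. - X j) * (\<Prod>i=k+2..r+1. \<Prod>j=i+2..r+1. qdiff i j))"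
    (is "anti _ ?L = anti _ ?R")
proof -
  let ?S = "X 1 ^ r * (\<Prod>i=1..k. \<Prod>j=i+2..r+1. - X j)"
  let ?T = "\<Prod>i=k+2..r+1. \<Prod>j=i+2..r+1. qdiff i j"
  let ?D = "(\<Prod>j=k+3..r+1. qdiff (k+1) j) - (\<Prod>j=k+3..r+1. - X j)"
  let ?B = "{k+2..r+1}"
  have "(\<Prod>i=k+1..r+1. \<Prod>j=i+2..r+1. qdiff i j) = (\<Prod>j=k+3..r+1. qdiff (k+1) j) * ?T"
    using assms by (subst prod.atLeast_Suc_atMost) (simp_all add: numeral_eq_Suc)
  moreover have "(\<Prod>i=1..k+1. \<Prod>j=i+2..r+1. - X j) = (\<Prod>i=1..k. \<Prod>j=i+2..r+1. - X j) * (\<Prod>j=k+3..r+1. - X j)"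
    by (simp add: numeral_eq_Suc)
  ultimately have eq: "?L - ?R = ?S * (?D * ?T)"
    by (simp only: algebra_simps)
  have "anti (r+1) (?S * (?D * ?T)) = 0"
  proof (cases "k + 2 \<le> r")
    case False
    then show ?thesis by (simp add: anti_0)
  next
    case True
    \<comment> \<open>A treated row contains every variable of the block, because \<open>i + 2 \<le> k + 2\<close>.\<close>
    have "symm ?B (\<Prod>j=i+2..r+1. - X j)" if "i \<in> {1..k}" for i
    proof (rule symm_prod_permuted)
      fix a b j
      show "act (transpose a b) (- X j) = - X (transpose a b j)"
        using act_diff[of "transpose a b" 0 "X j"] by (simp add: act_0 act_X)
    qed (use that in auto)
    then have S: "symm ?B ?S"
      by (intro symm_mult symm_power symm_X symm_prod[of "{1..k}"]) auto
    have "symdeg ?B (card {k+3..r+1} - 1) ?D"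
      unfolding qdiff_def using True by (intro prod_shift_diff_symdeg symm_mult symm_Q symm_X) auto
    moreover have "symdeg ?B (\<Sum>{..<r+1-(k+2)}) ?T"
      using True by (intro symdeg_nonadj) auto
    ultimately have "symdeg ?B ((card {k+3..r+1} - 1) + \<Sum>{..<r+1-(k+2)}) (?S * (?D * ?T))"
      using S by (intro symdeg_mult_symm symdeg_mult)
    moreover have "(card {k+3..r+1} - 1) + \<Sum>{..<r+1-(k+2)} < \<Sum>{..<card ?B}"
    proof -
      have "card ?B = Suc (r+1-(k+2))" "card {k+3..r+1} - 1 < r+1-(k+2)" using True by auto
      then show ?thesis by (simp add: lessThan_Suc)
    qed
    ultimately show ?thesis
      by (rule anti_eq_0_if_symdeg) auto
  qed
  then show ?thesis
    using eq anti_diff[of "r+1" ?L ?R] by simp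
qed

text \<open>With all rows at \<open>q = 0\<close> the polynomial is \<open>top_term\<close>.\<close>

lemma bracket_X1_power: "anti (r+1) (xsum 1 ^ r * nonadj r) = vand (r+1)"
proof -
  have frozen: "anti (r+1) (X 1 ^ r * (\<Prod>i=1..k. \<Prod>j=i+2..r+1. - X j) * (\<Prod>i=k+1..r+1. \<Prod>j=i+2..r+1. qdiff i j)) =
      anti (r+1) (xsum 1 ^ r * nonadj r)" if "k \<le> r + 1" for k
    using that
  proof (induction k)
    case 0
    then show ?case by (simp add: nonadj_def xsum_def)
  next
    case (Suc k)
    then show ?case using anti_freeze_factor[of k r] by (simp only: Suc_eq_plus1 add.assoc one_add_one)
  qed
  have "vand (r+1) = anti (r+1) (X 1 ^ r * (\<Prod>i=1..r+1. \<Prod>j=i+2..r+1. - X j) *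
      (\<Prod>i=(r+1)+1..r+1. \<Prod>j=i+2..r+1. qdiff i j))"
    unfolding vand_eq_anti_top_term top_term_def by simp
  also have "\<dots> = anti (r+1) (xsum 1 ^ r * nonadj r)"
    by (rule frozen) simp
  finally show ?thesis by simp
qed

subsection \<open>Quadratic relations\<close>

lemma symm_xsum_above:
  assumes "B \<subseteq> {1..k}"
  shows "symm B (xsum k)"
proof (rule symmI)
  fix a b assume "a \<in> B" "b \<in> B"
  then have "transpose a b permutes {1..k}"
    using assms by (intro permutes_swap_id) auto
  from sum.permute[OF this, of X] show "act (transpose a b) (xsum k) = xsum k"
    by (simp add: xsum_def act_sum act_X comp_def)
qed

lemma symm_xsum_below: "B \<inter> {1..k} = {} \<Longrightarrow> symm B (xsum k)"
  unfolding xsum_def by (intro symm_sum symm_X) auto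

lemma symdeg_xsum: "finite B \<Longrightarrow> symdeg B 1 (xsum k)"
  unfolding xsum_def by (intro symdeg_sum) (metis symdeg_X symdeg_symm symm_X)

lemma act_qdiff: "bij \<sigma> \<Longrightarrow> act \<sigma> (qdiff i j) = qdiff (\<sigma> i) (\<sigma> j)"
  by (simp add: qdiff_def act_diff act_mult act_Q act_X)

text \<open>The nonadjacent pairs together with \<open>(i, i+1)\<close> are the nonadjacent pairs inside \<open>{1..i}\<close>, all
  pairs from \<open>{1..i}\<close> to \<open>{i+1..r+1}\<close>, and the nonadjacent pairs inside \<open>{i+1..r+1}\<close>. The middle part
  is symmetric in both blocks.\<close>

lemma qdiff_nonadj_split:
  assumes "i \<in> {1..r}"
  shows "qdiff i (i+1) * nonadj r =
    (\<Prod>a=1..i. \<Prod>b=a+2..i. qdiff a b) * (\<Prod>a=1..i. \<Prod>b=i+1..r+1. qdiff a b) *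
    (\<Prod>a=i+1..r+1. \<Prod>b=a+2..r+1. qdiff a b)"
proof -
  let ?g = "\<lambda>(a,b). qdiff a b"
  let ?A = "SIGMA a:{1..i}. {a+2..i}" and ?M = "SIGMA a:{1..i}. {i+1..r+1}"
    and ?E = "SIGMA a:{i+1..r+1}. {a+2..r+1}" and ?N = "SIGMA a:{1..r+1}. {a+2..r+1}"
  have sig: "(\<Prod>a\<in>I. \<Prod>b\<in>J a. qdiff a b) = (\<Prod>p\<in>Sigma I J. ?g p)"
    if "finite I" "\<And>a. finite (J a)" for I and J :: "nat \<Rightarrow> nat set"
    using that by (intro prod.Sigma) auto
  have "qdiff i (i+1) * nonadj r = (\<Prod>p\<in>insert (i,i+1) ?N. ?g p)"
    unfolding nonadj_def by (subst sig) auto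
  also have "insert (i,i+1) ?N = (?A \<union> ?M) \<union> ?E"
    using assms by auto
  also have "(\<Prod>p\<in>\<dots>. ?g p) = (\<Prod>p\<in>?A. ?g p) * (\<Prod>p\<in>?M. ?g p) * (\<Prod>p\<in>?E. ?g p)"
    by (subst prod.union_disjoint, simp, simp, force)+ simp
  finally show ?thesis
    by (simp only: sig finite_atLeastAtMost)
qed

text \<open>The factors \<open>y\<^sub>k\<close> with \<open>k < i\<close> are symmetric in the block \<open>{i+1..r+1}\<close>, those with \<open>k > i\<close> in the
  block \<open>{1..i}\<close>, and \<open>y\<^sub>i\<close> in both. For the first block to escape the vanishing principle at least
  \<open>i - 1\<close> factors with \<open>k < i\<close> are needed, for the second at least \<open>r - i\<close> factors with \<open>k > i\<close>;
  together these exceed \<open>r - 2\<close>.\<close>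

lemma anti_relation:
  assumes i: "i \<in> {1..r}" and e: "(\<Sum>k=1..r. e k) + 2 \<le> r"
  shows "anti (r+1) (xsum i * qdiff i (i+1) * (\<Prod>k=1..r. xsum k ^ e k) * nonadj r) = 0"
proof -
  let ?A = "\<Prod>a=1..i. \<Prod>b=a+2..i. qdiff a b" and ?M = "\<Prod>a=1..i. \<Prod>b=i+1..r+1. qdiff a b"
    and ?E = "\<Prod>a=i+1..r+1. \<Prod>b=a+2..r+1. qdiff a b"
  let ?F = "xsum i * ((\<Prod>k=1..r. xsum k ^ e k) * (?A * ?M * ?E))"
  have eq: "xsum i * qdiff i (i+1) * (\<Prod>k=1..r. xsum k ^ e k) * nonadj r = ?F"
    unfolding qdiff_nonadj_split[OF i, symmetric] by (simp only: ac_simps)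
  have split: "{1..r} = {1..<i} \<union> {i} \<union> {i+1..r}"
    using i by auto
  have esum: "(\<Sum>k=1..r. e k) = (\<Sum>k=1..<i. e k) + e i + (\<Sum>k=i+1..r. e k)"
    unfolding split by (subst sum.union_disjoint, simp, simp, force)+ simp
  have "anti (r+1) ?F = 0"
  proof (cases "(\<Sum>k=1..<i. e k) < i - 1")
    case True
    let ?B = "{1..i}"
    have "symdeg ?B (\<Sum>k=1..r. if k < i then e k else 0) (\<Prod>k=1..r. xsum k ^ e k)"
    proof (rule symdeg_prod)
      fix k assume "k \<in> {1..r}"
      show "symdeg ?B (if k < i then e k else 0) (xsum k ^ e k)"
      proof (cases "k < i")
        case True
        then show ?thesis using symdeg_power[OF symdeg_xsum[of ?B k], of "e k"] by simp
      next
        case False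
        then show ?thesis by (simp add: symdeg_symm symm_power symm_xsum_above)
      qed
    qed
    moreover have "(\<Sum>k=1..r. if k < i then e k else 0) = (\<Sum>k=1..<i. e k)"
      unfolding sum.inter_filter[symmetric, OF finite_atLeastAtMost]
      using i by (intro sum.cong) auto
    moreover have "symdeg ?B (\<Sum>{..<i-1}) ?A"
      using i by (intro symdeg_nonadj) auto
    moreover have "symm ?B ?M"
    proof (rule symm_prod_permuted)
      fix a b k assume "a \<in> ?B" "b \<in> ?B" "k \<in> ?B"
      then show "act (transpose a b) (\<Prod>j=i+1..r+1. qdiff k j) = (\<Prod>j=i+1..r+1. qdiff (transpose a b k) j)"
        unfolding act_prod[OF bij_transpose] act_qdiff[OF bij_transpose]
        by (intro prod.cong) (auto simp: transpose_def)
    qed simp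
    moreover have "symm ?B ?E"
      unfolding qdiff_def by (intro symm_prod symm_diff symm_mult symm_Q symm_X) auto
    ultimately have "symdeg ?B ((\<Sum>k=1..<i. e k) + (\<Sum>{..<i-1} + 0 + 0)) ?F"
      by (intro symdeg_mult_symm symdeg_mult) (auto intro: symdeg_symm symm_xsum_above)
    moreover have "(\<Sum>k=1..<i. e k) + (\<Sum>{..<i-1} + 0 + 0) < \<Sum>{..<card ?B}"
    proof -
      have c: "card ?B = Suc (i-1)" using i by auto
      show ?thesis unfolding c lessThan_Suc using True by simp
    qed
    ultimately show ?thesis
      by (rule anti_eq_0_if_symdeg) (use i in auto)
  next
    case False
    let ?B = "{i+1..r+1}"
    have small: "(\<Sum>k=i+1..r. e k) < r - i"
      using False e i unfolding esum by auto
    have "symdeg ?B (\<Sum>k=1..r. if i + 1 \<le> k then e k else 0) (\<Prod>k=1..r. xsum k ^ e k)"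
    proof (rule symdeg_prod)
      fix k assume "k \<in> {1..r}"
      show "symdeg ?B (if i + 1 \<le> k then e k else 0) (xsum k ^ e k)"
      proof (cases "i + 1 \<le> k")
        case True
        then show ?thesis using symdeg_power[OF symdeg_xsum[of ?B k], of "e k"] by simp
      next
        case False
        then show ?thesis by (simp add: symdeg_symm symm_power symm_xsum_below)
      qed
    qed
    moreover have "(\<Sum>k=1..r. if i + 1 \<le> k then e k else 0) = (\<Sum>k=i+1..r. e k)"
      unfolding sum.inter_filter[symmetric, OF finite_atLeastAtMost]
      using i by (intro sum.cong) auto
    moreover have "symdeg ?B (\<Sum>{..<r+1-(i+1)}) ?E"
      using i by (intro symdeg_nonadj) auto
    moreover have "symm ?B ?M"
    proof (rule symm_prod)
      fix k assume k: "k \<in> {1..i}"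
      show "symm ?B (\<Prod>b=i+1..r+1. qdiff k b)"
      proof (rule symm_prod_permuted)
        fix a b j assume "a \<in> ?B" "b \<in> ?B" "j \<in> ?B"
        then show "act (transpose a b) (qdiff k j) = qdiff k (transpose a b j)"
          using k unfolding act_qdiff[OF bij_transpose] by (auto simp: transpose_def)
      qed simp
    qed
    moreover have "symm ?B ?A"
      unfolding qdiff_def by (intro symm_prod symm_diff symm_mult symm_Q symm_X) auto
    ultimately have "symdeg ?B ((\<Sum>k=i+1..r. e k) + (0 + 0 + \<Sum>{..<r+1-(i+1)})) ?F"
      by (intro symdeg_mult_symm symdeg_mult) (auto intro: symdeg_symm symm_xsum_below)
    moreover have "(\<Sum>k=i+1..r. e k) + (0 + 0 + \<Sum>{..<r+1-(i+1)}) < \<Sum>{..<card ?B}"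
    proof -
      have "card ?B = Suc (r-i)" using i by auto
      then show ?thesis using small by (simp add: lessThan_Suc)
    qed
    ultimately show ?thesis
      by (rule anti_eq_0_if_symdeg) (use i in auto)
  qed
  then show ?thesis
    by (simp only: eq)
qed

subsection \<open>Remixed Eulerian numbers indexed by multisets\<close>

definition xsum_mon :: "nat multiset \<Rightarrow> mp" where
  "xsum_mon M = prod_mset (image_mset xsum M)"

lemma xsum_mon_eq_prod:
  assumes "set_mset M \<subseteq> {1..r}"
  shows "xsum_mon M = (\<Prod>k=1..r. xsum k ^ count M k)"
proof -
  have "xsum_mon M = (\<Prod>k\<in>set_mset M. xsum k ^ count M k)"
    by (simp add: xsum_mon_def image_prod_mset_multiplicity)
  also have "\<dots> = (\<Prod>k=1..r. xsum k ^ count M k)"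
    using assms by (intro prod.mono_neutral_left) (auto simp: not_in_iff)
  finally show ?thesis .
qed

text \<open>The sum of all variables is symmetric and hence has degree \<open>0\<close> in the sense of \<open>symdeg\<close>.\<close>

lemma anti_xsum_top:
  assumes "size M < r"
  shows "anti (r+1) (xsum (r+1) * xsum_mon M * nonadj r) = 0"
proof -
  let ?B = "{1..r+1}"
  have "symdeg ?B (size M) (xsum_mon M)"
  proof (induction M)
    case empty
    then show ?case by (simp add: xsum_mon_def symdeg_symm symm_1)
  next
    case (add x M)
    then show ?case using symdeg_mult[OF symdeg_xsum[of ?B x]] by (simp add: xsum_mon_def)
  qed
  moreover have "symdeg ?B (\<Sum>{..<r+1-1}) (nonadj r)"
    unfolding nonadj_def by (intro symdeg_nonadj) auto
  ultimately have "symdeg ?B (size M + \<Sum>{..<r+1-1}) (xsum (r+1) * (xsum_mon M * nonadj r))"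
    by (intro symdeg_mult_symm symdeg_mult symm_xsum_above) auto
  then have "anti (r+1) (xsum (r+1) * (xsum_mon M * nonadj r)) = 0"
    by (rule anti_eq_0_if_symdeg) (use assms in \<open>auto simp: lessThan_Suc\<close>)
  then show ?thesis by (simp only: mult.assoc)
qed

lemma size_eq_sum_count:
  fixes M :: "nat multiset"
  assumes "set_mset M \<subseteq> {1..r}"
  shows "size M = (\<Sum>k=1..r. count M k)"
  unfolding size_multiset_overloaded_eq
  using assms by (intro sum.mono_neutral_left) (auto simp: not_in_iff)

text \<open>Letters outside \<open>{1..r}\<close> give \<open>0\<close>. For the letters \<open>0\<close> and \<open>r+1\<close> this is the value of the bracket
  itself, as \<open>y\<^sub>0 = 0\<close> and as \<open>y\<^bsub>r+1\<^esub>\<close> is symmetric; so the relations below hold without exceptions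
  at the ends.\<close>

definition A_mset :: "nat \<Rightarrow> nat multiset \<Rightarrow> complex poly fract" where
  "A_mset r M = (if set_mset M \<subseteq> {1..r} then to_fract (A (map (count M) [1..<r+1])) else 0)"

lemma A_mset_eqI:
  assumes "set_mset M \<subseteq> {1..r}" "anti (r+1) (xsum_mon M * nonadj r) = vand (r+1) * C a"
  shows "A_mset r M = to_fract a"
proof -
  let ?c = "map (count M) [1..<r+1]"
  have "(\<Prod>k=1..length ?c. xsum k ^ (?c ! (k - 1))) = xsum_mon M"
    unfolding xsum_mon_eq_prod[OF assms(1)] by (intro prod.cong) (auto simp del: upt_Suc)
  then have "A ?c = a"
    using assms(2) by (intro A_eqI) (simp del: upt_Suc)
  then show ?thesis
    using assms(1) by (simp add: A_mset_def)
qed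

lemma A_mset_exists:
  assumes "set_mset M \<subseteq> {0..r+1}" "size M = r"
  obtains a where "anti (r+1) (xsum_mon M * nonadj r) = vand (r+1) * C a" "A_mset r M = to_fract a"
proof (cases "set_mset M \<subseteq> {1..r}")
  case True
  have "deg_le (r+1) (\<Sum>i=1..r+1. \<Sum>j=i+2..r+1. 1) (nonadj r)"
    unfolding nonadj_def qdiff_def Q_def
    by (intro deg_le_prod deg_le_diff deg_le_X deg_le_C_mult) auto
  moreover have "(\<Sum>i=1..r+1. \<Sum>j=i+2..r+1. 1) = \<Sum>{..<r}"
    using sum_row_lengths[of 1 "r+1"] by simp
  moreover have "deg_le (r+1) (\<Sum>k=1..r. count M k * 1) (xsum_mon M)"
    unfolding xsum_mon_eq_prod[OF True] xsum_def by (intro deg_le_prod deg_le_power deg_le_sum deg_le_X) auto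
  ultimately have "deg_le (r+1) ((\<Sum>k=1..r. count M k * 1) + \<Sum>{..<r}) (xsum_mon M * nonadj r)"
    using deg_le_mult by metis
  moreover have "(\<Sum>k=1..r. count M k * 1) + \<Sum>{..<r} = \<Sum>{..<r+1}"
    using size_eq_sum_count[OF True] assms(2) by (simp add: lessThan_Suc)
  ultimately obtain a where "anti (r+1) (xsum_mon M * nonadj r) = vand (r+1) * C a"
    using anti_multiple_of_vand by metis
  then show thesis
    using that A_mset_eqI[OF True] by blast
next
  case False
  have "anti (r+1) (xsum_mon M * nonadj r) = 0"
  proof (cases "0 \<in># M")
    case True
    have "xsum 0 = 0" by (simp add: xsum_def)
    then have "xsum_mon M = 0"
      using True by (force simp: xsum_mon_def)
    then show ?thesis by (simp add: anti_0)
  next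
    case 0: False
    have "r + 1 \<in># M"
    proof (rule ccontr)
      assume "r + 1 \<notin># M"
      then have "x \<in> {1..r}" if "x \<in># M" for x
        using that 0 assms(1) by (cases "x = 0"; cases "x = r + 1") auto
      then show False using False by blast
    qed
    then obtain N where M: "M = add_mset (r+1) N"
      by (metis insert_DiffM)
    then show ?thesis
      using anti_xsum_top[of N r] assms(2) by (simp add: xsum_mon_def)
  qed
  then show thesis
    using that[of 0] False by (simp add: A_mset_def C_0)
qed


text \<open>The difference \<open>(1 + q) y\<^sub>i\<^sup>2 - q y\<^sub>i y\<^bsub>i-1\<^esub> - y\<^sub>i y\<^bsub>i+1\<^esub>\<close> factors as \<open>y\<^sub>i (q x\<^sub>i - x\<^bsub>i+1\<^esub>)\<close>.\<close>

lemma A_mset_relation: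
  assumes "i \<in> {1..r}" "set_mset M \<subseteq> {1..r}" "size M + 2 = r"
  shows "(1 + q) * A_mset r (add_mset i (add_mset i M)) =
    q * A_mset r (add_mset i (add_mset (i-1) M)) + A_mset r (add_mset i (add_mset (i+1) M))"
proof -
  let ?t = "[:0, 1:] :: complex poly"
  obtain a where a: "anti (r+1) (xsum_mon (add_mset i (add_mset i M)) * nonadj r) = vand (r+1) * C a"
      "A_mset r (add_mset i (add_mset i M)) = to_fract a"
    by (rule A_mset_exists[of "add_mset i (add_mset i M)" r]) (use assms in auto)
  obtain b where b: "anti (r+1) (xsum_mon (add_mset i (add_mset (i-1) M)) * nonadj r) = vand (r+1) * C b"
      "A_mset r (add_mset i (add_mset (i-1) M)) = to_fract b"
    by (rule A_mset_exists[of "add_mset i (add_mset (i-1) M)" r]) (use assms in auto)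
  obtain c where c: "anti (r+1) (xsum_mon (add_mset i (add_mset (i+1) M)) * nonadj r) = vand (r+1) * C c"
      "A_mset r (add_mset i (add_mset (i+1) M)) = to_fract c"
    by (rule A_mset_exists[of "add_mset i (add_mset (i+1) M)" r]) (use assms in auto)
  have y1: "xsum i = xsum (i-1) + X i"
    using assms(1) by (cases i) (simp_all add: xsum_def)
  have y2: "xsum (i+1) = xsum i + X (i+1)"
    by (simp add: xsum_def)
  have alg: "(1 + Q) * (yi * (yi * m) * p) - (Q * (yi * (y0 * m) * p) + yi * ((yi + x') * m) * p) =
      yi * (Q * x - x') * m * p" if "yi = y0 + x" for yi y0 x x' m p :: mp
    unfolding that by (simp add: algebra_simps)
  have "(\<Sum>k=1..r. count M k) + 2 \<le> r"
    using assms(3) size_eq_sum_count[OF assms(2)] by simp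
  then have "anti (r+1) (xsum i * qdiff i (i+1) * xsum_mon M * nonadj r) = 0"
    unfolding xsum_mon_eq_prod[OF assms(2)] using assms(1) by (intro anti_relation)
  then have "anti (r+1) ((1 + Q) * (xsum i * (xsum i * xsum_mon M) * nonadj r) -
      (Q * (xsum i * (xsum (i-1) * xsum_mon M) * nonadj r) + xsum i * (xsum (i+1) * xsum_mon M) * nonadj r)) = 0"
    unfolding y2 alg[OF y1] qdiff_def .
  moreover have "1 + Q = C (1 + ?t)"
    by (simp add: Q_def C_add C_1)
  ultimately have "anti (r+1) (C (1 + ?t) * (xsum_mon (add_mset i (add_mset i M)) * nonadj r)) =
      anti (r+1) (C ?t * (xsum_mon (add_mset i (add_mset (i-1) M)) * nonadj r)) +
      anti (r+1) (xsum_mon (add_mset i (add_mset (i+1) M)) * nonadj r)"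
    unfolding anti_diff anti_add Q_def by (simp add: xsum_mon_def)
  then have "C (1 + ?t) * (vand (r+1) * C a) = C ?t * (vand (r+1) * C b) + vand (r+1) * C c"
    unfolding anti_C_mult a(1) b(1) c(1) .
  then have "vand (r+1) * C ((1 + ?t) * a) = vand (r+1) * C (?t * b + c)"
    unfolding C_mult C_add[of "?t * b"] by (simp only: distrib_left mult.left_commute)
  then have "C ((1 + ?t) * a) = C (?t * b + c)"
    using vand_nonzero[of r] by (simp only: mult_cancel_left) simp
  then have "(1 + ?t) * a = ?t * b + c"
    by (simp only: C_eq_iff)
  then have "to_fract ((1 + ?t) * a) = to_fract (?t * b + c)"
    by (simp only:)
  then show ?thesis
    unfolding a(2) b(2) c(2) q_def by (simp only: to_fract_add to_fract_mult to_fract_1)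
qed

lemma A_mset_replicate:
  assumes "r \<ge> 1"
  shows "A_mset r (replicate_mset r 1) = 1"
proof -
  have "A_mset r (replicate_mset r 1) = to_fract 1"
  proof (rule A_mset_eqI)
    show "anti (r+1) (xsum_mon (replicate_mset r 1) * nonadj r) = vand (r+1) * C 1"
      using bracket_X1_power[of r] by (simp add: xsum_mon_def C_1)
  qed (use assms in auto)
  then show ?thesis by simp
qed

section \<open>\<open>q\<close>-integers and the gambler's ruin\<close>

lemma qint_0: "qint 0 = 0" and qint_Suc: "qint (Suc n) = qint n + q ^ n" and qint_1: "qint (Suc 0) = 1"
  by (simp_all add: qint_def)

lemma qint_add: "qint (m + n) = qint m + q ^ m * qint n"
  by (induction n) (simp_all add: qint_0 qint_Suc algebra_simps power_add)

text \<open>The value of the polynomial at \<open>q = 1\<close> is \<open>n\<close>.\<close>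

lemma qint_nonzero:
  assumes "n > 0"
  shows "qint n \<noteq> 0"
proof -
  have "qint n = to_fract (\<Sum>k<n. [:0, 1:] ^ k)"
  proof (induction n)
    case (Suc n)
    have "to_fract (a ^ n) = to_fract a ^ n" for a :: "complex poly"
      by (induction n) simp_all
    then have "to_fract ([:0, 1:] ^ n) = q ^ n"
      by (simp add: q_def)
    then show ?case using Suc by (simp add: qint_Suc)
  qed (simp add: qint_0)
  moreover have "poly (\<Sum>k<n. [:0, 1:] ^ k) (1::complex) = of_nat n"
    by (simp add: poly_sum)
  then have "(\<Sum>k<n. [:0, 1::complex:] ^ k) \<noteq> 0"
    using assms by (metis of_nat_0_eq_iff less_irrefl poly_0)
  ultimately show ?thesis by (metis to_fract_eq_0_iff)
qed

text \<open>The relation says that successive differences of \<open>f\<close> form a geometric progression of ratio \<open>q\<close>,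
  so \<open>f\<close> is an affine function of the \<open>q\<close>-integers and is determined by its boundary values.\<close>

lemma gamblers_ruin:
  fixes f :: "nat \<Rightarrow> complex poly fract"
  assumes rel: "\<And>k. 0 < k \<Longrightarrow> k < n \<Longrightarrow> (1 + q) * f k = q * f (k - 1) + f (k + 1)"
    and n: "n > 0" and k: "k \<le> n"
  shows "f k = qint (n - k) / qint n * q ^ k * f 0 + qint k / qint n * f n"
proof -
  have step: "f (Suc k) - f k = q ^ k * (f 1 - f 0)" if "k < n" for k
    using that
  proof (induction k)
    case (Suc k)
    have "f (Suc (Suc k)) - f (Suc k) = q * (f (Suc k) - f k)"
      using rel[of "Suc k"] Suc.prems by (simp add: algebra_simps)
    then show ?case using Suc by simp
  qed simp
  have lin: "f k = f 0 + qint k * (f 1 - f 0)" if "k \<le> n" for k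
    using that
  proof (induction k)
    case (Suc k)
    then have "f (Suc k) = f 0 + qint k * (f 1 - f 0) + q ^ k * (f 1 - f 0)"
      using step[of k] by (simp add: diff_eq_eq add.commute)
    then show ?case by (simp only: qint_Suc distrib_right add.assoc)
  qed (simp add: qint_0)
  have nz: "qint n \<noteq> 0" using n by (rule qint_nonzero)
  have split: "qint n = qint k + q ^ k * qint (n - k)"
    using qint_add[of k "n - k"] k by simp
  have alg: "N = a + p * b \<Longrightarrow> N * (x + a * d) = p * b * x + a * (x + N * d)"
    for N a p b x d :: "complex poly fract"
    by (simp add: algebra_simps)
  have "qint n * f k = q ^ k * qint (n - k) * f 0 + qint k * (f 0 + qint n * (f 1 - f 0))"
    unfolding lin[OF k] by (rule alg[OF split])
  then have "qint n * f k = q ^ k * qint (n - k) * f 0 + qint k * f n"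
    using lin[of n] by simp
  then show ?thesis
    using nz by (simp add: field_simps)
qed

section \<open>Components of finite sets of integers\<close>

text \<open>For \<open>j \<in> I\<close>, the ends of the maximal interval of integers in \<open>I\<close> that contains \<open>j\<close>.\<close>

definition comp_lo :: "int set \<Rightarrow> int \<Rightarrow> int" where
  "comp_lo I j = Min {a. a \<le> j \<and> {a..j} \<subseteq> I}"

definition comp_hi :: "int set \<Rightarrow> int \<Rightarrow> int" where
  "comp_hi I j = Max {b. j \<le> b \<and> {j..b} \<subseteq> I}"

lemma comp_lo_eqI:
  assumes "finite I" "a \<le> j" "{a..j} \<subseteq> I" "a - 1 \<notin> I"
  shows "comp_lo I j = a"
  unfolding comp_lo_def
proof (rule Min_eqI)
  show "finite {a. a \<le> j \<and> {a..j} \<subseteq> I}"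
    by (rule finite_subset[OF _ assms(1)]) auto
  fix a' assume "a' \<in> {a. a \<le> j \<and> {a..j} \<subseteq> I}"
  then have "a - 1 \<notin> {a'..j}" using assms(4) by blast
  then show "a \<le> a'" using assms(2) by auto
qed (use assms in auto)

lemma comp_hi_eqI:
  assumes "finite I" "j \<le> b" "{j..b} \<subseteq> I" "b + 1 \<notin> I"
  shows "comp_hi I j = b"
  unfolding comp_hi_def
proof (rule Max_eqI)
  show "finite {b. j \<le> b \<and> {j..b} \<subseteq> I}"
    by (rule finite_subset[OF _ assms(1)]) auto
  fix b' assume "b' \<in> {b. j \<le> b \<and> {j..b} \<subseteq> I}"
  then have "b + 1 \<notin> {j..b'}" using assms(4) by blast
  then show "b' \<le> b" using assms(2) by auto
qed (use assms in auto)

lemma comp_lo: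
  assumes "finite I" "j \<in> I"
  shows "comp_lo I j \<le> j" "{comp_lo I j..j} \<subseteq> I" "comp_lo I j - 1 \<notin> I"
proof -
  let ?S = "{a. a \<le> j \<and> {a..j} \<subseteq> I}"
  have S: "finite ?S" "j \<in> ?S"
    by (rule finite_subset[OF _ assms(1)]) (use assms in auto)
  then have m: "comp_lo I j \<in> ?S"
    unfolding comp_lo_def by (intro Min_in) auto
  then show 1: "comp_lo I j \<le> j" and 2: "{comp_lo I j..j} \<subseteq> I" by auto
  show "comp_lo I j - 1 \<notin> I"
  proof
    assume "comp_lo I j - 1 \<in> I"
    moreover have "{comp_lo I j - 1..j} = insert (comp_lo I j - 1) {comp_lo I j..j}"
      using 1 by auto
    ultimately have "comp_lo I j - 1 \<in> ?S" using 1 2 by simp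
    then have "comp_lo I j \<le> comp_lo I j - 1"
      unfolding comp_lo_def[of I j] using S(1) by (intro Min_le) auto
    then show False by simp
  qed
qed

lemma comp_hi:
  assumes "finite I" "j \<in> I"
  shows "j \<le> comp_hi I j" "{j..comp_hi I j} \<subseteq> I" "comp_hi I j + 1 \<notin> I"
proof -
  let ?S = "{b. j \<le> b \<and> {j..b} \<subseteq> I}"
  have S: "finite ?S" "j \<in> ?S"
    by (rule finite_subset[OF _ assms(1)]) (use assms in auto)
  then have m: "comp_hi I j \<in> ?S"
    unfolding comp_hi_def by (intro Max_in) auto
  then show 1: "j \<le> comp_hi I j" and 2: "{j..comp_hi I j} \<subseteq> I" by auto
  show "comp_hi I j + 1 \<notin> I"
  proof
    assume "comp_hi I j + 1 \<in> I"
    moreover have "{j..comp_hi I j + 1} = insert (comp_hi I j + 1) {j..comp_hi I j}"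
      using 1 by auto
    ultimately have "comp_hi I j + 1 \<in> ?S" using 1 2 by simp
    then have "comp_hi I j + 1 \<le> comp_hi I j"
      unfolding comp_hi_def[of I j] using S(1) by (intro Max_ge) auto
    then show False by simp
  qed
qed

section \<open>Inserting letters one by one\<close>

text \<open>\<open>landing I j i\<close> is the probability that a letter \<open>i\<close>, inserted into the occupied set
  \<open>I - {j}\<close>, comes to rest at \<open>j\<close>. The occupied set after the insertion is the argument because the
  elementary weight refers to the component of \<open>j\<close> in this set.\<close>

definition landing :: "int set \<Rightarrow> int \<Rightarrow> int \<Rightarrow> complex poly fract" where
  "landing I j i = (if {min i j..max i j} \<subseteq> I then wtq (comp_lo I j) (comp_hi I j) j i else 0)"

text \<open>The probability that inserting the letters of a word fills exactly the set \<open>I\<close>. The word is given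
  in reverse: its head is inserted last.\<close>

fun fill :: "int list \<Rightarrow> int set \<Rightarrow> complex poly fract" where
  "fill [] I = (if I = {} then 1 else 0)"
| "fill (i # w) I = (\<Sum>j\<in>I. fill w (I - {j}) * landing I j i)"

lemma fill_card: "finite I \<Longrightarrow> card I \<noteq> length w \<Longrightarrow> fill w I = 0"
proof (induction w arbitrary: I)
  case (Cons i w)
  have "fill w (I - {j}) = 0" if "j \<in> I" for j
  proof (rule Cons.IH)
    have "card I > 0" using that Cons.prems(1) by (auto simp: card_gt_0_iff)
    then show "card (I - {j}) \<noteq> length w"
      using that Cons.prems by simp
  qed (use Cons.prems in simp)
  then show ?case by simp
qed auto

lemma wtq_shift: "wtq (a + s) (b + s) (j + s) (i + s) = wtq a b j i"
  by (simp add: wtq_def)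

lemma wtq_same: "a \<le> i \<Longrightarrow> wtq a b i i = 1"
  by (simp add: wtq_def qint_nonzero)

lemma landing_shift:
  assumes "finite I" "j \<in> I"
  shows "landing ((\<lambda>x. x + s) ` I) (j + s) (i + s) = landing I j i"
proof -
  have img: "{a + s..b + s} \<subseteq> (\<lambda>x. x + s) ` I \<longleftrightarrow> {a..b} \<subseteq> I" for a b
  proof -
    have "{a + s..b + s} = (\<lambda>x. x + s) ` {a..b}" by simp
    moreover have "inj (\<lambda>x. x + s)" by (simp add: inj_def)
    ultimately show ?thesis by (simp only: inj_image_subset_iff)
  qed
  have mem: "a + s \<in> (\<lambda>x. x + s) ` I \<longleftrightarrow> a \<in> I" for a by auto
  have mem': "a + s - 1 \<in> (\<lambda>x. x + s) ` I \<longleftrightarrow> a - 1 \<in> I"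
    "a + s + 1 \<in> (\<lambda>x. x + s) ` I \<longleftrightarrow> a + 1 \<in> I" for a
    using mem[of "a - 1"] mem[of "a + 1"] by (simp_all add: algebra_simps)
  have "comp_lo ((\<lambda>x. x + s) ` I) (j + s) = comp_lo I j + s"
    using comp_lo[OF assms] assms(1)
    by (intro comp_lo_eqI) (simp_all only: img mem' finite_imageI add_right_mono not_False_eq_True)
  moreover have "comp_hi ((\<lambda>x. x + s) ` I) (j + s) = comp_hi I j + s"
    using comp_hi[OF assms] assms(1)
    by (intro comp_hi_eqI) (simp_all only: img mem' finite_imageI add_right_mono not_False_eq_True)
  moreover have "min (i + s) (j + s) = min i j + s" "max (i + s) (j + s) = max i j + s" by auto
  ultimately show ?thesis
    unfolding landing_def by (simp only: img wtq_shift)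
qed

lemma fill_shift: "finite I \<Longrightarrow> fill (map (\<lambda>x. x + s) w) ((\<lambda>x. x + s) ` I) = fill w I"
proof (induction w arbitrary: I)
  case (Cons i w)
  have "fill (map (\<lambda>x. x + s) (i # w)) ((\<lambda>x. x + s) ` I) =
      (\<Sum>j\<in>I. fill (map (\<lambda>x. x + s) w) ((\<lambda>x. x + s) ` I - {j + s}) *
        landing ((\<lambda>x. x + s) ` I) (j + s) (i + s))"
    by (simp add: sum.reindex)
  also have "\<dots> = (\<Sum>j\<in>I. fill w (I - {j}) * landing I j i)"
  proof (rule sum.cong)
    fix j assume "j \<in> I"
    have "(\<lambda>x. x + s) ` I - {j + s} = (\<lambda>x. x + s) ` (I - {j})" by auto
    then show "fill (map (\<lambda>x. x + s) w) ((\<lambda>x. x + s) ` I - {j + s}) *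
        landing ((\<lambda>x. x + s) ` I) (j + s) (i + s) = fill w (I - {j}) * landing I j i"
      using Cons \<open>j \<in> I\<close> by (simp add: landing_shift)
  qed simp
  finally show ?case by simp
qed simp

text \<open>A free place \<open>s\<close> is a barrier: it can neither be crossed nor influence the components beyond it.\<close>

lemma landing_below:
  assumes "finite I" "s \<notin> I" "k \<in> I" "k < s"
  shows "landing I k i = (if i < s then landing (I \<inter> {..<s}) k i else 0)"
proof (cases "i < s")
  case False
  then have "s \<in> {min i k..max i k}" using assms by auto
  then have "\<not> {min i k..max i k} \<subseteq> I" using assms(2) by blast
  then show ?thesis using False by (simp add: landing_def)
next
  case True
  let ?I = "I \<inter> {..<s}"
  have k: "k \<in> ?I" using assms by auto
  have f: "finite ?I" using assms by auto
  have "comp_lo I k = comp_lo ?I k"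
    by (rule comp_lo_eqI[OF assms(1)]) (use comp_lo[OF f k] assms in auto)
  moreover have "comp_hi I k = comp_hi ?I k"
  proof (rule comp_hi_eqI[OF assms(1)])
    have "comp_hi ?I k \<in> ?I" using comp_hi(1,2)[OF f k] by auto
    then show "comp_hi ?I k + 1 \<notin> I"
      using comp_hi(3)[OF f k] assms(2) by (cases "comp_hi ?I k + 1 = s") auto
  qed (use comp_hi[OF f k] in auto)
  moreover have "{min i k..max i k} \<subseteq> I \<longleftrightarrow> {min i k..max i k} \<subseteq> ?I"
    using True assms by auto
  ultimately show ?thesis using True by (simp add: landing_def)
qed

lemma landing_above:
  assumes "finite I" "s \<notin> I" "k \<in> I" "s < k"
  shows "landing I k i = (if s < i then landing (I \<inter> {s<..}) k i else 0)"
proof (cases "s < i")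
  case False
  then have "s \<in> {min i k..max i k}" using assms by auto
  then have "\<not> {min i k..max i k} \<subseteq> I" using assms(2) by blast
  then show ?thesis using False by (simp add: landing_def)
next
  case True
  let ?I = "I \<inter> {s<..}"
  have k: "k \<in> ?I" using assms by auto
  have f: "finite ?I" using assms by auto
  have "comp_hi I k = comp_hi ?I k"
    by (rule comp_hi_eqI[OF assms(1)]) (use comp_hi[OF f k] assms in auto)
  moreover have "comp_lo I k = comp_lo ?I k"
  proof (rule comp_lo_eqI[OF assms(1)])
    have "comp_lo ?I k \<in> ?I" using comp_lo(1,2)[OF f k] by auto
    then show "comp_lo ?I k - 1 \<notin> I"
      using comp_lo(3)[OF f k] assms(2) by (cases "comp_lo ?I k - 1 = s") auto
  qed (use comp_lo[OF f k] in auto)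
  moreover have "{min i k..max i k} \<subseteq> I \<longleftrightarrow> {min i k..max i k} \<subseteq> ?I"
    using True assms by auto
  ultimately show ?thesis using True by (simp add: landing_def)
qed

lemma split_at:
  fixes s :: int
  assumes "s \<notin> I"
  shows "I = (I \<inter> {..<s}) \<union> (I \<inter> {s<..})"
proof -
  have "x < s \<or> s < x" if "x \<in> I" for x
    using that assms by (cases x s rule: linorder_cases) auto
  then show ?thesis by blast
qed

text \<open>The letters below and above a place that stays free fill their sides independently of each other.
  A letter equal to \<open>s\<close> would have occupied \<open>s\<close>, or found it occupied.\<close>

lemma fill_separate:
  assumes "finite I" "s \<notin> I"
  shows "fill w I = (if s \<in> set w then 0
    else fill (filter (\<lambda>x. x < s) w) (I \<inter> {..<s}) * fill (filter (\<lambda>x. s < x) w) (I \<inter> {s<..}))"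
  using assms
proof (induction w arbitrary: I)
  case Nil
  have "I = (I \<inter> {..<s}) \<union> (I \<inter> {s<..})"
    by (rule split_at) (rule Nil(2))
  then have "I = {} \<longleftrightarrow> I \<inter> {..<s} = {} \<and> I \<inter> {s<..} = {}"
    by blast
  then show ?case by auto
next
  case (Cons i w)
  let ?L = "I \<inter> {..<s}" and ?R = "I \<inter> {s<..}"
  let ?wl = "filter (\<lambda>x. x < s) w" and ?wr = "filter (\<lambda>x. s < x) w"
  have I: "I = ?L \<union> ?R" by (rule split_at) (rule Cons.prems(2))
  have fin: "finite ?L" "finite ?R" "?L \<inter> ?R = {}" using Cons.prems by auto
  have l: "fill w (I - {k}) * landing I k i =
      (if s \<in> set w \<or> \<not> i < s then 0 else fill ?wl (?L - {k}) * landing ?L k i * fill ?wr ?R)"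
    if "k \<in> ?L" for k
  proof -
    have "(I - {k}) \<inter> {..<s} = ?L - {k}" "(I - {k}) \<inter> {s<..} = ?R" using that by auto
    then show ?thesis
      using that Cons.prems Cons.IH[of "I - {k}"] by (simp add: landing_below[of I s k])
  qed
  have r: "fill w (I - {k}) * landing I k i =
      (if s \<in> set w \<or> \<not> s < i then 0 else fill ?wl ?L * (fill ?wr (?R - {k}) * landing ?R k i))"
    if "k \<in> ?R" for k
  proof -
    have "(I - {k}) \<inter> {..<s} = ?L" "(I - {k}) \<inter> {s<..} = ?R - {k}" using that by auto
    then show ?thesis
      using that Cons.prems Cons.IH[of "I - {k}"] by (simp add: landing_above[of I s k])
  qed
  have "fill (i # w) I = (\<Sum>k\<in>?L \<union> ?R. fill w (I - {k}) * landing I k i)"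
    by (simp flip: I)
  also have "\<dots> = (\<Sum>k\<in>?L. fill w (I - {k}) * landing I k i) + (\<Sum>k\<in>?R. fill w (I - {k}) * landing I k i)"
    by (rule sum.union_disjoint[OF fin])
  also have "(\<Sum>k\<in>?L. fill w (I - {k}) * landing I k i) =
      (if s \<in> set w \<or> \<not> i < s then 0 else fill (i # ?wl) ?L * fill ?wr ?R)"
    by (subst sum.cong[OF refl l]) (simp_all add: sum_distrib_right)
  also have "(\<Sum>k\<in>?R. fill w (I - {k}) * landing I k i) =
      (if s \<in> set w \<or> \<not> s < i then 0 else fill ?wl ?L * fill (i # ?wr) ?R)"
    by (subst sum.cong[OF refl r]) (simp_all add: sum_distrib_left)
  finally show ?case
    by (cases i s rule: linorder_cases) auto
qed

lemma landing_interval: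
  assumes "j \<in> {a..b}"
  shows "landing {a..b} j i = (if i \<in> {a..b} then wtq a b j i else 0)"
proof -
  have "comp_lo {a..b} j = a" "comp_hi {a..b} j = b"
    using assms by (auto intro!: comp_lo_eqI comp_hi_eqI)
  moreover have "{min i j..max i j} \<subseteq> {a..b} \<longleftrightarrow> i \<in> {a..b}"
    using assms by (auto simp: min_def max_def)
  ultimately show ?thesis by (simp add: landing_def)
qed

text \<open>Here \<open>j\<close> is the place where the last letter comes to rest. The part above \<open>j\<close> is shifted so that
  it starts at \<open>1\<close> again.\<close>

lemma fill_interval_Cons:
  "fill (i # w) {1..n} = (\<Sum>j\<in>{1..n}. if i \<in> {1..n} \<and> j \<notin> set w
      then wtq 1 n j i * (fill (filter (\<lambda>x. x < j) w) {1..j-1} *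
        fill (map (\<lambda>x. x - j) (filter (\<lambda>x. j < x) w)) {1..n-j}) else 0)"
  unfolding fill.simps
proof (rule sum.cong)
  fix j :: int assume j: "j \<in> {1..n}"
  have "({1..n} - {j}) \<inter> {..<j} = {1..j-1}" "({1..n} - {j}) \<inter> {j<..} = (\<lambda>x. x + j) ` {1..n-j}"
    using j by auto
  moreover have "filter (\<lambda>x. j < x) w = map (\<lambda>x. x + j) (map (\<lambda>x. x - j) (filter (\<lambda>x. j < x) w))"
    by (simp add: map_idI)
  then have "fill (filter (\<lambda>x. j < x) w) ((\<lambda>x. x + j) ` {1..n-j}) =
      fill (map (\<lambda>x. x - j) (filter (\<lambda>x. j < x) w)) {1..n-j}"
    by (metis fill_shift finite_atLeastAtMost_int)
  ultimately show "fill w ({1..n} - {j}) * landing {1..n} j i = (if i \<in> {1..n} \<and> j \<notin> set w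
      then wtq 1 n j i * (fill (filter (\<lambda>x. x < j) w) {1..j-1} *
        fill (map (\<lambda>x. x - j) (filter (\<lambda>x. j < x) w)) {1..n-j}) else 0)"
    using fill_separate[of "{1..n} - {j}" j w] landing_interval[OF j] by simp
qed simp

text \<open>With nothing to the left of \<open>1\<close> to be filled, a new letter \<open>1\<close> must cross all \<open>k\<close> letters that are
  present, with probability \<open>1 / (k+1)\<^sub>q\<close>.\<close>

lemma fill_replicate:
  "finite I \<Longrightarrow> I \<subseteq> {1..} \<Longrightarrow> fill (replicate k 1) I = (if I = {1..int k} then 1 / qfact k else 0)"
proof (induction k arbitrary: I)
  case 0
  then show ?case by (auto simp: qfact_def)
next
  case (Suc k)
  have "fill (replicate (Suc k) 1) I =
      (\<Sum>j\<in>I. (if I - {j} = {1..int k} then 1 / qfact k else 0) * landing I j 1)"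
    unfolding replicate_Suc fill.simps
  proof (rule sum.cong)
    fix j assume "j \<in> I"
    have "fill (replicate k 1) (I - {j}) = (if I - {j} = {1..int k} then 1 / qfact k else 0)"
      by (rule Suc.IH) (use Suc.prems in auto)
    then show "fill (replicate k 1) (I - {j}) * landing I j 1 =
        (if I - {j} = {1..int k} then 1 / qfact k else 0) * landing I j 1"
      by simp
  qed simp
  also have "\<dots> = (if I = {1..int (Suc k)} then 1 / qfact (Suc k) else 0)"
  proof (cases "I = {1..int (Suc k)}")
    case True
    have "(if I - {j} = {1..int k} then 1 / qfact k else 0) * landing I j 1 =
        (if j = int (Suc k) then 1 / qfact (Suc k) else 0)" if "j \<in> I" for j
    proof (cases "j = int (Suc k)")
      case j: True
      have "{1..int (Suc k)} - {int (Suc k)} = {1..int k}" by auto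
      moreover have "landing {1..int (Suc k)} (int (Suc k)) 1 = 1 / qint (Suc k)"
        by (subst landing_interval) (auto simp: wtq_def qint_1 nat_add_distrib)
      ultimately show ?thesis
        using j True by (simp add: qfact_def)
    next
      case j: False
      then have "int (Suc k) \<in> I - {j}" using True by auto
      moreover have "int (Suc k) \<notin> {1..int k}" by simp
      ultimately have "I - {j} \<noteq> {1..int k}" by metis
      then show ?thesis using j by simp
    qed
    then have "(\<Sum>j\<in>I. (if I - {j} = {1..int k} then 1 / qfact k else 0) * landing I j 1) =
        (\<Sum>j\<in>I. if j = int (Suc k) then 1 / qfact (Suc k) else 0)"
      by (rule sum.cong[OF refl])
    then show ?thesis
      using True by simp
  next
    case False
    have z: "(if I - {j} = {1..int k} then 1 / qfact k else 0) * landing I j 1 = 0" if j: "j \<in> I" for j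
    proof (cases "I - {j} = {1..int k}")
      case True
      have "j \<notin> {1..int k}" by (simp flip: True)
      moreover have "j \<ge> 1" using j Suc.prems by auto
      moreover have I: "I = insert j {1..int k}" using True j by (metis insert_Diff)
      moreover have "j \<noteq> int (Suc k)"
      proof
        assume "j = int (Suc k)"
        then have "I = {1..int (Suc k)}" unfolding I by auto
        then show False using False by contradiction
      qed
      ultimately have "int (Suc k) < j" by auto
      then have "int (Suc k) \<in> {min 1 j..max 1 j}" "int (Suc k) \<notin> I"
        unfolding I by auto
      then have "\<not> {min 1 j..max 1 j} \<subseteq> I" by blast
      then show ?thesis unfolding landing_def by simp
    qed simp
    have "(\<Sum>j\<in>I. (if I - {j} = {1..int k} then 1 / qfact k else 0) * landing I j 1) = 0"
      by (rule sum.neutral) (use z in blast)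
    then show ?thesis using False by (simp only: if_False)
  qed
  finally show ?case .
qed

section \<open>Functionals that satisfy the quadratic relations\<close>

text \<open>The relations are those of the \<open>q\<close>-Klyachko algebra, with a linear functional \<open>L\<close> on its
  component of degree \<open>r\<close> evaluated at monomials.\<close>

locale klyachko =
  fixes r :: nat and L :: "int multiset \<Rightarrow> complex poly fract"
  assumes outside: "\<not> set_mset M \<subseteq> {1..int r} \<Longrightarrow> L M = 0"
    and relation: "i \<in> {1..int r} \<Longrightarrow> set_mset M \<subseteq> {1..int r} \<Longrightarrow> size M + 2 = r \<Longrightarrow>
      (1 + q) * L (add_mset i (add_mset i M)) =
      q * L (add_mset i (add_mset (i-1) M)) + L (add_mset i (add_mset (i+1) M))"
begin

text \<open>One step of the process. If \<open>i\<close> is already occupied and \<open>[a,b]\<close> is its component, then replacing \<open>i\<close>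
  by any \<open>j\<close> in \<open>[a-1,b+1]\<close> gives a sequence to which the relation with the doubled letter \<open>j\<close> applies for
  each inner \<open>j\<close>; this is the situation of the gambler's ruin.\<close>

lemma insert_letter:
  assumes I: "I \<subseteq> {1..int r}" and i: "i \<in> {1..int r}" and v: "set_mset v \<subseteq> {1..int r}"
    and sz: "card I + 1 + size v = r"
  shows "L (add_mset i (mset_set I + v)) =
    (\<Sum>j\<in>{1..int r} - I. landing (insert j I) j i * L (mset_set (insert j I) + v))"
proof -
  have fin: "finite I" using I finite_subset by blast
  show ?thesis
  proof (cases "i \<in> I")
    case False
    have "landing (insert j I) j i * L (mset_set (insert j I) + v) =
        (if j = i then L (add_mset i (mset_set I + v)) else 0)" if "j \<in> {1..int r} - I" for j
    proof (cases "j = i")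
      case True
      have "landing (insert i I) i i = 1"
        using comp_lo(1)[of "insert i I" i] fin by (simp add: landing_def wtq_same)
      then show ?thesis using True False fin by simp
    next
      case j: False
      then have "i \<in> {min i j..max i j}" "i \<notin> insert j I" using False by auto
      then have "landing (insert j I) j i = 0" unfolding landing_def by (meson subsetD)
      then show ?thesis using j by simp
    qed
    then show ?thesis
      using i False by simp
  next
    case True
    define a where "a = comp_lo I i"
    define b where "b = comp_hi I i"
    have a: "a \<le> i" "{a..i} \<subseteq> I" "a - 1 \<notin> I" and b: "i \<le> b" "{i..b} \<subseteq> I" "b + 1 \<notin> I"
      using comp_lo[OF fin True] comp_hi[OF fin True] by (auto simp: a_def b_def)
    have ab: "{a..b} \<subseteq> I"
    proof
      fix x assume "x \<in> {a..b}"
      then show "x \<in> I" using a(2) b(2) by (cases "x \<le> i") auto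
    qed
    \<comment> \<open>The walk runs between the free neighbours \<open>a - 1\<close> and \<open>b + 1\<close>, at distance \<open>n\<close>; step \<open>k\<close> is at \<open>a - 1 + k\<close>.\<close>
    define n where "n = nat (b - a + 2)"
    define f where "f = (\<lambda>k. L (add_mset (a - 1 + int k) (mset_set I + v)))"
    have "f (nat (i - a + 1)) = qint (n - nat (i - a + 1)) / qint n * q ^ nat (i - a + 1) * f 0 +
        qint (nat (i - a + 1)) / qint n * f n"
    proof (rule gamblers_ruin)
      fix k assume k: "0 < k" "k < n"
      define j where "j = a - 1 + int k"
      have j: "j \<in> {a..b}" using k by (auto simp: j_def n_def)
      then have jI: "j \<in> I" using ab by auto
      define M where "M = mset_set (I - {j}) + v"
      have M: "mset_set I + v = add_mset j M"
        using jI fin by (simp add: M_def mset_set.remove)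
      have "f k = L (add_mset j (add_mset j M))"
        by (simp add: f_def j_def[symmetric] M)
      moreover have "f (k - 1) = L (add_mset j (add_mset (j - 1) M))"
        using k by (simp add: f_def j_def[symmetric] M add_mset_commute) (simp add: j_def of_nat_diff algebra_simps)
      moreover have "f (k + 1) = L (add_mset j (add_mset (j + 1) M))"
        by (simp add: f_def j_def[symmetric] M add_mset_commute) (simp add: j_def algebra_simps)
      moreover have "(1 + q) * L (add_mset j (add_mset j M)) =
          q * L (add_mset j (add_mset (j-1) M)) + L (add_mset j (add_mset (j+1) M))"
      proof (rule relation)
        show "size M + 2 = r"
          using sz jI fin card_gt_0_iff[of I] by (auto simp: M_def)
        show "set_mset M \<subseteq> {1..int r}"
          using I v fin by (auto simp: M_def)
      qed (use jI I in auto)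
      ultimately show "(1 + q) * f k = q * f (k - 1) + f (k + 1)" by simp
    qed (use a b in \<open>auto simp: n_def\<close>)
    moreover have "f (nat (i - a + 1)) = L (add_mset i (mset_set I + v))"
      using a(1) by (simp add: f_def)
    moreover have "n - nat (i - a + 1) = nat (b - i + 1)"
      using a(1) b(1) by (simp add: n_def flip: nat_diff_distrib)
    ultimately have ruin: "L (add_mset i (mset_set I + v)) =
        qint (nat (b - i + 1)) / qint n * q ^ nat (i - a + 1) * f 0 + qint (nat (i - a + 1)) / qint n * f n"
      by simp
    have left: "landing (insert (a-1) I) (a-1) i = qint (nat (b - i + 1)) / qint n * q ^ nat (i - a + 1)"
    proof -
      have "{a-1..b} = insert (a-1) {a..b}" using a(1) b(1) by auto
      then have "comp_hi (insert (a-1) I) (a-1) = b"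
        using a(1) b ab fin by (intro comp_hi_eqI) auto
      moreover have "{a-1..i} = insert (a-1) {a..i}" using a(1) by auto
      then have "{min i (a-1)..max i (a-1)} \<subseteq> insert (a-1) I"
        using a(1,2) by (auto simp: min_def max_def)
      ultimately show ?thesis
        using a(1) by (simp add: landing_def wtq_def n_def algebra_simps)
    qed
    have right: "landing (insert (b+1) I) (b+1) i = qint (nat (i - a + 1)) / qint n"
    proof -
      have "{a..b+1} = insert (b+1) {a..b}" using a(1) b(1) by auto
      then have "comp_lo (insert (b+1) I) (b+1) = a"
        using a b(1) ab fin by (intro comp_lo_eqI) auto
      moreover have "{i..b+1} = insert (b+1) {i..b}" using b(1) by auto
      then have "{min i (b+1)..max i (b+1)} \<subseteq> insert (b+1) I"
        using b(1,2) by (auto simp: min_def max_def)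
      ultimately show ?thesis
        using b(1) by (simp add: landing_def wtq_def n_def algebra_simps)
    qed
    \<comment> \<open>A neighbour outside \<open>{1..r}\<close> may be included in the sum, as the functional vanishes there.\<close>
    have "(\<Sum>j\<in>{1..int r} - I. landing (insert j I) j i * L (mset_set (insert j I) + v)) =
        (\<Sum>j\<in>{a-1, b+1}. landing (insert j I) j i * L (mset_set (insert j I) + v))"
    proof (rule sum.mono_neutral_cong)
      fix j assume "j \<in> ({1..int r} - I) - {a-1, b+1}"
      then have j: "j \<notin> I" "j \<noteq> a - 1" "j \<noteq> b + 1" by auto
      have "\<exists>x\<in>{min i j..max i j}. x \<notin> insert j I"
      proof (cases "i < j")
        case True
        have "b + 1 \<in> {min i j..max i j}"
          using True j(3) b(1) subsetD[OF b(2), of j] j(1) by (cases "j \<le> b") auto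
        then show ?thesis using b(3) j(3) by (intro bexI[of _ "b + 1"]) auto
      next
        case False
        have "a - 1 \<in> {min i j..max i j}"
          using False j(2) a(1) subsetD[OF a(2), of j] j(1) by (cases "a \<le> j") auto
        then show ?thesis using a(3) j(2) by (intro bexI[of _ "a - 1"]) auto
      qed
      then have "landing (insert j I) j i = 0" unfolding landing_def by (meson subsetD)
      then show "landing (insert j I) j i * L (mset_set (insert j I) + v) = 0" by simp
    next
      fix j assume "j \<in> {a-1, b+1} - ({1..int r} - I)"
      then have "j \<notin> {1..int r}" using a(3) b(3) by auto
      then have "L (mset_set (insert j I) + v) = 0" using fin by (intro outside) auto
      then show "landing (insert j I) j i * L (mset_set (insert j I) + v) = 0" by simp
    qed auto
    also have "\<dots> = landing (insert (a-1) I) (a-1) i * L (mset_set (insert (a-1) I) + v) +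
        landing (insert (b+1) I) (b+1) i * L (mset_set (insert (b+1) I) + v)"
      using a(1) b(1) by simp
    also have "L (mset_set (insert (a-1) I) + v) = f 0"
      using a(3) fin by (simp add: f_def)
    also have "L (mset_set (insert (b+1) I) + v) = f n"
      using b(3) fin a(1) b(1) by (simp add: f_def n_def add.commute[of 1 b])
    finally show ?thesis
      unfolding ruin left right by simp
  qed
qed

text \<open>The first letters have been inserted and occupy \<open>I\<close>; the letters \<open>v\<close> are still waiting.\<close>

lemma expand:
  assumes "set w \<subseteq> {1..int r}" "set_mset v \<subseteq> {1..int r}" "length w + size v = r"
  shows "L (mset w + v) =
    (\<Sum>I | I \<subseteq> {1..int r} \<and> card I = length w. fill w I * L (mset_set I + v))"
  using assms
proof (induction w arbitrary: v)
  case Nil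
  have "{I. I \<subseteq> {1..int r} \<and> card I = length []} = {{}}"
    by (auto simp: finite_subset)
  then show ?case by simp
next
  case (Cons i w)
  let ?S = "\<lambda>n. {I. I \<subseteq> {1..int r} \<and> card I = n}"
  have finS: "finite (?S n)" for n by (rule finite_subset[of _ "Pow {1..int r}"]) auto
  have fin: "finite I" if "I \<in> ?S n" for I n using that finite_subset by blast
  have "L (mset (i # w) + v) = L (mset w + add_mset i v)" by simp
  also have "\<dots> = (\<Sum>I\<in>?S (length w). fill w I * L (mset_set I + add_mset i v))"
    using Cons.prems by (intro Cons.IH) auto
  also have "\<dots> = (\<Sum>I\<in>?S (length w). \<Sum>j\<in>{1..int r} - I.
      fill w I * (landing (insert j I) j i * L (mset_set (insert j I) + v)))"
    using Cons.prems by (intro sum.cong) (simp_all add: insert_letter sum_distrib_left)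
  also have "\<dots> = (\<Sum>(I,j)\<in>(SIGMA I:?S (length w). {1..int r} - I).
      fill w I * (landing (insert j I) j i * L (mset_set (insert j I) + v)))"
    by (rule sum.Sigma) (use finS in auto)
  also have "\<dots> = (\<Sum>(I,j)\<in>(SIGMA I:?S (length (i # w)). I).
      fill w (I - {j}) * (landing I j i * L (mset_set I + v)))"
  proof -
    have fwd: "insert j I \<in> ?S (length (i # w)) \<and> insert j I - {j} = I"
      if "I \<in> ?S (length w)" "j \<in> {1..int r} - I" for I j
      using that fin[of I "length w"] by simp
    have bwd: "I - {j} \<in> ?S (length w) \<and> insert j (I - {j}) = I \<and> j \<in> {1..int r}"
      if "I \<in> ?S (length (i # w))" "j \<in> I" for I j
      using that fin[of I "length (i # w)"] by (auto simp: insert_absorb)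
    let ?A = "SIGMA I:?S (length w). {1..int r} - I" and ?B = "SIGMA I:?S (length (i # w)). I"
    have A: "\<exists>I j. p = (I, j) \<and> I \<in> ?S (length w) \<and> j \<in> {1..int r} - I" if "p \<in> ?A" for p
      using that by (elim SigmaE) blast
    have B: "\<exists>I j. p = (I, j) \<and> I \<in> ?S (length (i # w)) \<and> j \<in> I" if "p \<in> ?B" for p
      using that by (elim SigmaE) blast
    show ?thesis
    proof (rule sum.reindex_bij_witness[where i = "\<lambda>(I,j). (I - {j}, j)" and j = "\<lambda>(I,j). (insert j I, j)"])
      fix p assume "p \<in> ?A"
      then obtain I j where p: "p = (I, j)" "I \<in> ?S (length w)" "j \<in> {1..int r} - I"
        using A by blast
      show "(case case p of (I, j) \<Rightarrow> (insert j I, j) of (I, j) \<Rightarrow> (I - {j}, j)) = p"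
        using fwd[OF p(2,3)] p(1) by simp
      show "(case p of (I, j) \<Rightarrow> (insert j I, j)) \<in> ?B"
        using fwd[OF p(2,3)] p(1) by simp
      show "(case case p of (I, j) \<Rightarrow> (insert j I, j) of
          (I, j) \<Rightarrow> fill w (I - {j}) * (landing I j i * L (mset_set I + v))) =
        (case p of (I, j) \<Rightarrow> fill w I * (landing (insert j I) j i * L (mset_set (insert j I) + v)))"
        using fwd[OF p(2,3)] p(1) by simp
    next
      fix p assume "p \<in> ?B"
      then obtain I j where p: "p = (I, j)" "I \<in> ?S (length (i # w))" "j \<in> I"
        using B by blast
      show "(case case p of (I, j) \<Rightarrow> (I - {j}, j) of (I, j) \<Rightarrow> (insert j I, j)) = p"
        using bwd[OF p(2,3)] p(1) by simp
      show "(case p of (I, j) \<Rightarrow> (I - {j}, j)) \<in> ?A"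
        using bwd[OF p(2,3)] p(1) by simp
    qed
  qed
  also have "\<dots> = (\<Sum>I\<in>?S (length (i # w)). \<Sum>j\<in>I. fill w (I - {j}) * (landing I j i * L (mset_set I + v)))"
    by (rule sum.Sigma[symmetric, OF finS]) (use fin in blast)
  also have "\<dots> = (\<Sum>I\<in>?S (length (i # w)). fill (i # w) I * L (mset_set I + v))"
    by (simp add: sum_distrib_right mult.assoc)
  finally show ?case .
qed

text \<open>After all \<open>r\<close> insertions the only set of \<open>r\<close> occupied places inside \<open>{1..r}\<close> is \<open>{1..r}\<close> itself.\<close>

lemma eq_fill:
  assumes "set w \<subseteq> {1..int r}" "length w = r"
  shows "L (mset w) = fill w {1..int r} * L (mset_set {1..int r})"
proof -
  have "I = {1..int r}" if "I \<subseteq> {1..int r}" "card I = length w" for I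
    by (rule card_subset_eq) (use that assms(2) in simp_all)
  then have "{I. I \<subseteq> {1..int r} \<and> card I = length w} = {{1..int r}}"
    using assms(2) by (intro equalityI subsetI) simp_all
  then show ?thesis
    using expand[of w "{#}"] assms by simp
qed

text \<open>The unknown value at \<open>{1,\<dots>,r}\<close> is eliminated by comparison with the constant word \<open>1\<dots>1\<close>.\<close>

lemma eq_qfact_fill:
  assumes "set w \<subseteq> {1..int r}" "length w = r" "r \<ge> 1"
  shows "L (mset w) = qfact r * fill w {1..int r} * L (replicate_mset r 1)"
proof -
  have "L (replicate_mset r 1) = fill (replicate r 1) {1..int r} * L (mset_set {1..int r})"
    using eq_fill[of "replicate r 1"] assms(3) by (simp add: mset_replicate) 
  also have "fill (replicate r 1) {1..int r} = 1 / qfact r"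
    by (subst fill_replicate) auto
  finally have "L (replicate_mset r 1) = L (mset_set {1..int r}) / qfact r" by simp
  moreover have "qfact r \<noteq> 0"
    by (simp add: qfact_def qint_nonzero)
  ultimately show ?thesis
    using eq_fill[OF assms(1,2)] by simp
qed

end

section \<open>Recursive structure of labeled trees\<close>

lemma finite_nodes: "finite (nodes T)"
  by (induction T) auto

lemma bs_image_nodes: "bs T ` nodes T = {1..int (size T)}"
proof (induction T)
  case (Node l x r)
  have "bs (Node l x r) ` nodes (Node l x r) =
      insert (int (size l) + 1) (bs l ` nodes l \<union> (\<lambda>k. int (size l) + 1 + k) ` bs r ` nodes r)"
    by (simp add: image_Un image_image)
  also have "\<dots> = {1..int (size (Node l x r))}"
    unfolding Node by auto
  finally show ?case .
qed auto

lemma labels_below_Nil: "labels_below T [] = {1..int (size T)}"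
  by (simp add: labels_below_def bs_image_nodes)

lemma labels_below_left: "labels_below (Node l x r) (False # v) = labels_below l v"
proof -
  have "{w \<in> nodes (Node l x r). prefix (False # v) w} = (#) False ` {w \<in> nodes l. prefix v w}"
    by auto
  then show ?thesis by (simp add: labels_below_def image_image)
qed

lemma labels_below_right:
  "labels_below (Node l x r) (True # v) = (\<lambda>k. k + (int (size l) + 1)) ` labels_below r v"
proof -
  have "{w \<in> nodes (Node l x r). prefix (True # v) w} = (#) True ` {w \<in> nodes r. prefix v w}"
    by auto
  then show ?thesis by (simp add: labels_below_def image_image add.commute add.left_commute)
qed

lemma labels_below_finite: "finite (labels_below T v)"
  and labels_below_nonempty: "v \<in> nodes T \<Longrightarrow> labels_below T v \<noteq> {}"
  and labels_below_subset: "labels_below T v \<subseteq> {1..int (size T)}"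
  using finite_nodes[of T] bs_image_nodes[of T] by (auto simp: labels_below_def)

lemma lo_Nil: "lo (Node l x r) [] = 1" and hi_Nil: "hi (Node l x r) [] = int (size l + size r + 1)"
  by (auto simp: lo_def hi_def labels_below_Nil intro!: Min_eqI Max_eqI)

lemma lo_left: "lo (Node l x r) (False # v) = lo l v" and hi_left: "hi (Node l x r) (False # v) = hi l v"
  by (simp_all add: lo_def hi_def labels_below_left)

lemma lo_right: "v \<in> nodes r \<Longrightarrow> lo (Node l x r) (True # v) = lo r v + (int (size l) + 1)"
  and hi_right: "v \<in> nodes r \<Longrightarrow> hi (Node l x r) (True # v) = hi r v + (int (size l) + 1)"
  unfolding lo_def hi_def labels_below_right
  by (rule mono_Min_commute[symmetric] mono_Max_commute[symmetric];
      simp add: monoI labels_below_finite labels_below_nonempty)+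

lemma lo_ge: "v \<in> nodes T \<Longrightarrow> 1 \<le> lo T v" and hi_le: "v \<in> nodes T \<Longrightarrow> hi T v \<le> int (size T)"
  unfolding lo_def hi_def
  using labels_below_subset[of T v] Min_in[OF labels_below_finite[of T v]]
    Max_in[OF labels_below_finite[of T v]] labels_below_nonempty[of v T] by auto

lemma compatible_Node:
  "compatible (Node l x r) f \<longleftrightarrow> f [] \<in> {1..int (size l + size r + 1)} \<and>
    compatible l (\<lambda>v. f (False # v)) \<and> compatible r (\<lambda>v. f (True # v) - (int (size l) + 1))"
  by (auto simp: compatible_def ball_Un lo_Nil hi_Nil lo_left hi_left lo_right hi_right algebra_simps)

lemma wt_Node:
  "wt (Node l x r) f = wtq 1 (int (size l + size r + 1)) (int (size l) + 1) (f []) *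
    (wt l (\<lambda>v. f (False # v)) * wt r (\<lambda>v. f (True # v) - (int (size l) + 1)))"
proof -
  let ?g = "\<lambda>v. wtq (lo (Node l x r) v) (hi (Node l x r) v) (bs (Node l x r) v) (f v)"
  have "wt (Node l x r) f = ?g [] * (\<Prod>v\<in>(#) False ` nodes l \<union> (#) True ` nodes r. ?g v)"
    unfolding wt_def nodes.simps by (subst prod.insert) (auto simp: finite_nodes)
  also have "(\<Prod>v\<in>(#) False ` nodes l \<union> (#) True ` nodes r. ?g v) =
      (\<Prod>v\<in>nodes l. ?g (False # v)) * (\<Prod>v\<in>nodes r. ?g (True # v))"
    by (subst prod.union_disjoint) (auto simp: finite_nodes prod.reindex)
  also have "(\<Prod>v\<in>nodes l. ?g (False # v)) = wt l (\<lambda>v. f (False # v))"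
    by (simp add: wt_def lo_left hi_left)
  also have "(\<Prod>v\<in>nodes r. ?g (True # v)) = wt r (\<lambda>v. f (True # v) - (int (size l) + 1))"
    unfolding wt_def
  proof (rule prod.cong)
    fix v assume "v \<in> nodes r"
    then show "?g (True # v) = wtq (lo r v) (hi r v) (bs r v) (f (True # v) - (int (size l) + 1))"
      using wtq_shift[of "lo r v" "int (size l) + 1" "hi r v" "bs r v" "f (True # v) - (int (size l) + 1)"]
      by (simp add: lo_right hi_right add.commute)
  qed simp
  finally show ?thesis
    by (simp add: lo_Nil hi_Nil)
qed

text \<open>Decreasing labelings by an arbitrary finite set \<open>S\<close> of positions, with colors \<open>c\<close> attached to the
  positions. Subtrees then inherit labelings by subsets of \<open>S\<close>, and the labels never need to be
  standardized.\<close>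

definition labelings :: "'a tree \<Rightarrow> nat set \<Rightarrow> (nat \<Rightarrow> int) \<Rightarrow> (node \<Rightarrow> nat) set" where
  "labelings T S c = {dec \<in> extensional (nodes T). bij_betw dec (nodes T) S \<and>
     (\<forall>v\<in>nodes T. \<forall>w\<in>nodes T. strict_prefix v w \<longrightarrow> dec w < dec v) \<and> compatible T (c \<circ> dec)}"

text \<open>The positions used in the left and in the right subtree when the root has in-order label \<open>j\<close>: the
  root carries the largest position, and compatibility forces the colors in the left subtree to be
  less than \<open>j\<close> and those in the right subtree to be greater.\<close>

definition lefts :: "nat set \<Rightarrow> (nat \<Rightarrow> int) \<Rightarrow> int \<Rightarrow> nat set" where
  "lefts S c j = {p \<in> S - {Max S}. c p < j}"

definition rights :: "nat set \<Rightarrow> (nat \<Rightarrow> int) \<Rightarrow> int \<Rightarrow> nat set" where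
  "rights S c j = {p \<in> S - {Max S}. j < c p}"

text \<open>Off the nodes the value is \<open>undefined\<close>, as the extensionality of labelings requires.\<close>

definition glue :: "nat \<Rightarrow> 'a tree \<Rightarrow> 'a tree \<Rightarrow> (node \<Rightarrow> nat) \<Rightarrow> (node \<Rightarrow> nat) \<Rightarrow> node \<Rightarrow> nat" where
  "glue m l r dl dr v = (case v of [] \<Rightarrow> m
     | b # u \<Rightarrow> if b then (if u \<in> nodes r then dr u else undefined)
                else (if u \<in> nodes l then dl u else undefined))"

lemma labelings_Leaf: "labelings Leaf S c = (if S = {} then {\<lambda>_. undefined} else {})"
  by (auto simp: labelings_def compatible_def bij_betw_def)

lemma compatible_range: "compatible T f \<Longrightarrow> v \<in> nodes T \<Longrightarrow> f v \<in> {1..int (size T)}"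
  using lo_ge[of v T] hi_le[of v T] by (fastforce simp: compatible_def)

text \<open>The colors tell the two subtrees apart, so \<open>dec\<close> maps the nodes of each subtree exactly onto the
  positions with a color on the corresponding side of \<open>j\<close>.\<close>

lemma labelings_NodeD:
  assumes d: "dec \<in> labelings (Node l x r) S c"
  defines "j \<equiv> int (size l) + 1"
  defines "dl \<equiv> restrict (\<lambda>v. dec (False # v)) (nodes l)"
  defines "dr \<equiv> restrict (\<lambda>v. dec (True # v)) (nodes r)"
  shows "c (Max S) \<in> {1..int (size l + size r + 1)}"
    and "j \<notin> c ` (S - {Max S})"
    and "dl \<in> labelings l (lefts S c j) c"
    and "dr \<in> labelings r (rights S c j) (\<lambda>p. c p - j)"
    and "dec = glue (Max S) l r dl dr"
proof -
  let ?T = "Node l x r"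
  have ext: "dec \<in> extensional (nodes ?T)" and bij: "bij_betw dec (nodes ?T) S"
    and mono: "\<And>v w. v \<in> nodes ?T \<Longrightarrow> w \<in> nodes ?T \<Longrightarrow> strict_prefix v w \<Longrightarrow> dec w < dec v"
    and comp: "compatible ?T (c \<circ> dec)"
    using d by (auto simp: labelings_def)
  have inj: "inj_on dec (nodes ?T)" and img: "dec ` nodes ?T = S"
    using bij by (auto simp: bij_betw_def)
  have le: "dec w \<le> dec []" if "w \<in> nodes ?T" for w
    using that mono[of "[]" w] by (cases w) (auto simp: strict_prefix_def)
  have max: "Max S = dec []"
    unfolding img[symmetric] using le finite_nodes[of ?T] by (intro Max_eqI) auto
  have root: "c (dec []) \<in> {1..int (size l + size r + 1)}"
    and cl: "compatible l (\<lambda>v. c (dec (False # v)))"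
    and cr: "compatible r (\<lambda>v. c (dec (True # v)) - j)"
    using comp unfolding compatible_Node j_def by auto
  show "c (Max S) \<in> {1..int (size l + size r + 1)}"
    using root by (simp add: max)
  have ltj: "c (dec (False # v)) < j" if "v \<in> nodes l" for v
    using compatible_range[OF cl that] by (simp add: j_def)
  have gtj: "c (dec (True # v)) > j" if "v \<in> nodes r" for v
    using compatible_range[OF cr that] by simp
  have rest: "S - {Max S} = (\<lambda>v. dec (False # v)) ` nodes l \<union> (\<lambda>v. dec (True # v)) ` nodes r"
  proof -
    let ?N = "(#) False ` nodes l \<union> (#) True ` nodes r"
    have "S = insert (dec []) (dec ` ?N)"
      using img by simp
    moreover have "dec [] \<notin> dec ` ?N"
      by (subst inj_on_image_mem_iff[OF inj]) auto
    ultimately have "S - {Max S} = dec ` ?N"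
      unfolding max by simp
    then show ?thesis by (simp only: image_Un image_image)
  qed
  show "j \<notin> c ` (S - {Max S})"
    unfolding rest using ltj gtj by (auto simp: image_iff)
  have L: "lefts S c j = (\<lambda>v. dec (False # v)) ` nodes l"
    unfolding lefts_def rest using ltj gtj by (auto dest: less_asym)
  have R: "rights S c j = (\<lambda>v. dec (True # v)) ` nodes r"
    unfolding rights_def rest using ltj gtj by (auto dest: less_asym)
  show "dl \<in> labelings l (lefts S c j) c"
    unfolding labelings_def
  proof (intro CollectI conjI ballI impI)
    show "bij_betw dl (nodes l) (lefts S c j)"
    proof -
      have "inj_on (dec \<circ> (#) False) (nodes l)"
        by (intro comp_inj_on inj_on_subset[OF inj]) auto
      then show ?thesis
        unfolding L dl_def bij_betw_def by (simp add: inj_on_def)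
    qed
    show "compatible l (c \<circ> dl)"
      using cl by (simp add: compatible_def dl_def)
    fix v w assume "v \<in> nodes l" "w \<in> nodes l" "strict_prefix v w"
    then show "dl w < dl v"
      using mono[of "False # v" "False # w"] by (simp add: dl_def)
  qed (simp add: dl_def)
  show "dr \<in> labelings r (rights S c j) (\<lambda>p. c p - j)"
    unfolding labelings_def
  proof (intro CollectI conjI ballI impI)
    show "bij_betw dr (nodes r) (rights S c j)"
    proof -
      have "inj_on (dec \<circ> (#) True) (nodes r)"
        by (intro comp_inj_on inj_on_subset[OF inj]) auto
      then show ?thesis
        unfolding R dr_def bij_betw_def by (simp add: inj_on_def)
    qed
    show "compatible r ((\<lambda>p. c p - j) \<circ> dr)"
      using cr by (simp add: compatible_def dr_def)
    fix v w assume "v \<in> nodes r" "w \<in> nodes r" "strict_prefix v w"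
    then show "dr w < dr v"
      using mono[of "True # v" "True # w"] by (simp add: dr_def)
  qed (simp add: dr_def)
  show "dec = glue (Max S) l r dl dr"
  proof
    fix v
    show "dec v = glue (Max S) l r dl dr v"
    proof (cases "v \<in> nodes ?T")
      case True
      then show ?thesis by (auto simp: glue_def max dl_def dr_def)
    next
      case False
      then have "dec v = undefined" using ext by (simp add: extensional_def)
      then show ?thesis using False by (auto simp: glue_def split: list.splits)
    qed
  qed
qed

lemma card_lefts_rights:
  assumes "finite S" "S \<noteq> {}" "j \<notin> c ` (S - {Max S})"
  shows "card (lefts S c j) + card (rights S c j) + 1 = card S"
proof -
  have "c p < j \<or> j < c p" if "p \<in> S - {Max S}" for p
    using that assms(3) by (cases "c p" j rule: linorder_cases) auto
  then have "S - {Max S} = lefts S c j \<union> rights S c j"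
    by (auto simp: lefts_def rights_def)
  moreover have "card (lefts S c j \<union> rights S c j) = card (lefts S c j) + card (rights S c j)"
    using assms(1) by (intro card_Un_disjoint) (auto simp: lefts_def rights_def)
  ultimately show ?thesis
    using card.remove[OF assms(1) Max_in[OF assms(1,2)]] by simp
qed

lemma labelings_NodeI:
  assumes S: "finite S" "S \<noteq> {}" and j: "j = int (size l) + 1"
    and "c (Max S) \<in> {1..int (size l + size r + 1)}" "j \<notin> c ` (S - {Max S})"
    and l: "dl \<in> labelings l (lefts S c j) c"
    and r: "dr \<in> labelings r (rights S c j) (\<lambda>p. c p - j)"
  shows "glue (Max S) l r dl dr \<in> labelings (Node l x r) S c"
    and "restrict (\<lambda>v. glue (Max S) l r dl dr (False # v)) (nodes l) = dl"
    and "restrict (\<lambda>v. glue (Max S) l r dl dr (True # v)) (nodes r) = dr"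
proof -
  let ?T = "Node l x r" and ?d = "glue (Max S) l r dl dr"
  have el: "dl \<in> extensional (nodes l)" and bl: "bij_betw dl (nodes l) (lefts S c j)"
    and ml: "\<And>v w. v \<in> nodes l \<Longrightarrow> w \<in> nodes l \<Longrightarrow> strict_prefix v w \<Longrightarrow> dl w < dl v"
    and cl: "compatible l (c \<circ> dl)"
    using l by (auto simp: labelings_def)
  have er: "dr \<in> extensional (nodes r)" and br: "bij_betw dr (nodes r) (rights S c j)"
    and mr: "\<And>v w. v \<in> nodes r \<Longrightarrow> w \<in> nodes r \<Longrightarrow> strict_prefix v w \<Longrightarrow> dr w < dr v"
    and cr: "compatible r ((\<lambda>p. c p - j) \<circ> dr)"
    using r by (auto simp: labelings_def)
  have dN: "?d [] = Max S" by (simp add: glue_def)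
  have dF: "?d (False # v) = dl v" if "v \<in> nodes l" for v using that by (simp add: glue_def)
  have dT: "?d (True # v) = dr v" if "v \<in> nodes r" for v using that by (simp add: glue_def)
  show "restrict (\<lambda>v. ?d (False # v)) (nodes l) = dl"
    using el dF by (auto simp: restrict_def extensional_def)
  show "restrict (\<lambda>v. ?d (True # v)) (nodes r) = dr"
    using er dT by (auto simp: restrict_def extensional_def)
  have inL: "dl v \<in> lefts S c j" if "v \<in> nodes l" for v using bl that by (auto simp: bij_betw_def)
  have inR: "dr v \<in> rights S c j" if "v \<in> nodes r" for v using br that by (auto simp: bij_betw_def)
  have below: "p < Max S" if "p \<in> lefts S c j \<union> rights S c j" for p
  proof -
    have "p \<in> S" "p \<noteq> Max S" using that by (auto simp: lefts_def rights_def)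
    then show ?thesis using Max_ge[OF S(1), of p] by simp
  qed
  have split: "S = insert (Max S) (lefts S c j \<union> rights S c j)"
  proof -
    have "c p < j \<or> j < c p" if "p \<in> S" "p \<noteq> Max S" for p
      using that assms(5) by (cases "c p" j rule: linorder_cases) auto
    then show ?thesis using Max_in[OF S] by (auto simp: lefts_def rights_def)
  qed
  have bij: "bij_betw ?d (nodes ?T) S"
    unfolding bij_betw_def
  proof
    let ?F = "(#) False ` nodes l" and ?G = "(#) True ` nodes r"
    have F: "?d ` ?F = lefts S c j" and G: "?d ` ?G = rights S c j"
      using bl br by (simp_all add: image_image dF dT bij_betw_def cong: image_cong)
    then show "?d ` nodes ?T = S"
      using split by (simp add: dN image_Un)
    have "inj_on (?d \<circ> (#) False) (nodes l)"
      using bl by (simp add: bij_betw_def dF cong: inj_on_cong)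
    then have "inj_on ?d ?F"
      by (rule inj_on_imageI)
    moreover have "inj_on (?d \<circ> (#) True) (nodes r)"
      using br by (simp add: bij_betw_def dT cong: inj_on_cong)
    then have "inj_on ?d ?G"
      by (rule inj_on_imageI)
    moreover have "?d ` ?F \<inter> ?d ` ?G = {}"
      unfolding F G by (auto simp: lefts_def rights_def)
    ultimately have "inj_on ?d (?F \<union> ?G)"
      unfolding inj_on_Un by blast
    moreover have "Max S \<notin> ?d ` (?F \<union> ?G)"
      unfolding image_Un F G using below by blast
    ultimately show "inj_on ?d (nodes ?T)"
      by (auto simp: dN)
  qed
  have mono: "?d w < ?d v" if vw: "v \<in> nodes ?T" "w \<in> nodes ?T" "strict_prefix v w" for v w
  proof (cases v)
    case Nil
    then have "w \<noteq> []" using vw(3) by auto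
    then have "?d w \<in> lefts S c j \<union> rights S c j"
      using vw(2) inL inR dF dT by auto
    then show ?thesis using below Nil dN by simp
  next
    case (Cons b v')
    then obtain w' where "w = b # w'" "strict_prefix v' w'"
      using vw(3) by (cases w) auto
    then show ?thesis
      using vw Cons ml mr dF dT by auto
  qed
  have "compatible ?T (c \<circ> ?d)"
    unfolding compatible_Node using assms(4) cl cr dN dF dT
    by (auto simp: compatible_def j)
  moreover have "?d \<in> extensional (nodes ?T)"
    by (auto simp: extensional_def glue_def split: list.splits)
  ultimately show "?d \<in> labelings ?T S c"
    using bij mono by (simp add: labelings_def)
qed

text \<open>At each node the root position and the positions of both subtrees are determined by \<open>S\<close> and \<open>c\<close>.\<close>

lemma labelings_unique:
  assumes "d \<in> labelings T S c" "e \<in> labelings T S c"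
  shows "d = e"
  using assms
proof (induction T arbitrary: S c d e)
  case Leaf
  then show ?case by (simp add: labelings_Leaf split: if_splits)
next
  case (Node l x r)
  show ?case
    using labelings_NodeD(3-5)[OF Node.prems(1)] labelings_NodeD(3-5)[OF Node.prems(2)]
      Node.IH by metis
qed

lemma card_labelings:
  assumes "dec \<in> labelings T S c"
  shows "card S = size T" "finite S"
proof -
  have bij: "bij_betw dec (nodes T) S" using assms by (simp add: labelings_def)
  have "card (nodes T) = size T"
  proof (induction T)
    case (Node l x r)
    have "card (nodes (Node l x r)) = Suc (card ((#) False ` nodes l \<union> (#) True ` nodes r))"
      by (simp add: finite_nodes card_insert_if image_iff)
    also have "card ((#) False ` nodes l \<union> (#) True ` nodes r) = card (nodes l) + card (nodes r)"
      by (subst card_Un_disjoint) (auto simp: finite_nodes card_image)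
    finally show ?case using Node by simp
  qed simp
  then show "card S = size T" using bij_betw_same_card[OF bij] by simp
  show "finite S" using bij finite_nodes[of T] bij_betw_finite by blast
qed

section \<open>The tree sum\<close>

text \<open>Trees paired with their labelings, which turns the recursion into a bijection of sets of pairs;
  uniqueness of labelings enters only when the labelings are forgotten at the end.\<close>

definition labeled_trees :: "nat set \<Rightarrow> (nat \<Rightarrow> int) \<Rightarrow> (unit tree \<times> (node \<Rightarrow> nat)) set" where
  "labeled_trees S c = {(T, dec). dec \<in> labelings T S c}"

definition tree_sum :: "nat set \<Rightarrow> (nat \<Rightarrow> int) \<Rightarrow> complex poly fract" where
  "tree_sum S c = (\<Sum>(T, dec)\<in>labeled_trees S c. wt T (c \<circ> dec))"

lemma finite_trees: "finite {T :: unit tree. size T < n}"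
proof (induction n)
  case (Suc n)
  have "{T :: unit tree. size T < Suc n} \<subseteq>
      insert Leaf ((\<lambda>(l, r). Node l () r) ` ({T. size T < n} \<times> {T. size T < n}))"
  proof
    fix T :: "unit tree" assume "T \<in> {T. size T < Suc n}"
    then show "T \<in> insert Leaf ((\<lambda>(l, r). Node l () r) ` ({T. size T < n} \<times> {T. size T < n}))"
      by (cases T) auto
  qed
  then show ?case using Suc finite_subset by blast
qed simp

lemma finite_labeled_trees: "finite (labeled_trees S c)"
proof (cases "finite S")
  case True
  have "labeled_trees S c \<subseteq>
      (SIGMA T:{T. size T < Suc (card S)}. (nodes T \<rightarrow>\<^sub>E S))"
  proof
    fix p assume "p \<in> labeled_trees S c"
    then obtain T dec where p: "p = (T, dec)" and d: "dec \<in> labelings T S c"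
      by (auto simp: labeled_trees_def)
    have "dec \<in> nodes T \<rightarrow>\<^sub>E S"
      using d by (auto simp: labelings_def bij_betw_def PiE_def)
    then show "p \<in> (SIGMA T:{T. size T < Suc (card S)}. (nodes T \<rightarrow>\<^sub>E S))"
      using card_labelings(1)[OF d] p by simp
  qed
  moreover have "finite (SIGMA T:{T :: unit tree. size T < Suc (card S)}. (nodes T \<rightarrow>\<^sub>E S))"
    using finite_trees True by (intro finite_SigmaI finite_PiE finite_nodes) auto
  ultimately show ?thesis by (rule finite_subset)
next
  case False
  then have "labeled_trees S c = {}"
    using card_labelings(2) by (auto simp: labeled_trees_def)
  then show ?thesis by simp
qed

lemma tree_sum_empty: "tree_sum {} c = 1"
proof -
  have "labeled_trees {} c = {(Leaf, \<lambda>_. undefined)}"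
  proof -
    have "T = Leaf" if "dec \<in> labelings T {} c" for T :: "unit tree" and dec
      using card_labelings(1)[OF that] by (cases T) auto
    then show ?thesis by (force simp: labeled_trees_def labelings_Leaf)
  qed
  then show ?thesis by (simp add: tree_sum_def wt_def)
qed

text \<open>A labeled tree is a root label \<open>j\<close> with a labeled left and a labeled right subtree. The condition on
  the number of positions says that \<open>j\<close> is the in-order label of the root.\<close>

lemma tree_sum_rec:
  assumes S: "finite S" "S \<noteq> {}"
  defines "n \<equiv> int (card S)" and "m \<equiv> Max S"
  shows "tree_sum S c = (\<Sum>j\<in>{1..n}. if c m \<in> {1..n} \<and> j \<notin> c ` (S - {m}) \<and> int (card (lefts S c j)) = j - 1
    then wtq 1 n j (c m) * (tree_sum (lefts S c j) c * tree_sum (rights S c j) (\<lambda>p. c p - j)) else 0)"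
proof -
  define J where "J = {j \<in> {1..n}. c m \<in> {1..n} \<and> j \<notin> c ` (S - {m}) \<and> int (card (lefts S c j)) = j - 1}"
  let ?L = "\<lambda>j. labeled_trees (lefts S c j) c" and ?R = "\<lambda>j. labeled_trees (rights S c j) (\<lambda>p. c p - j)"
  have prod: "tree_sum S1 c1 * tree_sum S2 c2 =
      (\<Sum>((l, dl), (r, dr))\<in>labeled_trees S1 c1 \<times> labeled_trees S2 c2. wt l (c1 \<circ> dl) * wt r (c2 \<circ> dr))"
    for S1 S2 c1 c2
    unfolding tree_sum_def sum_product sum.cartesian_product by (simp add: case_prod_beta)
  have finJ: "finite J" by (rule finite_subset[of _ "{1..n}"]) (auto simp: J_def)
  have card: "card (lefts S c j) + card (rights S c j) + 1 = card S" if "j \<notin> c ` (S - {m})" for j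
    using card_lefts_rights[OF S] that unfolding m_def by blast
  have "tree_sum S c = (\<Sum>(j, (l, dl), (r, dr))\<in>(SIGMA j:J. ?L j \<times> ?R j).
      wtq 1 n j (c m) * (wt l (c \<circ> dl) * wt r ((\<lambda>p. c p - j) \<circ> dr)))"
    unfolding tree_sum_def
  proof (rule sum.reindex_bij_witness[symmetric, where
      i = "\<lambda>(T, dec). (int (size (left T)) + 1, (left T, restrict (\<lambda>v. dec (False # v)) (nodes (left T))),
            (right T, restrict (\<lambda>v. dec (True # v)) (nodes (right T))))" and
      j = "\<lambda>(j, (l, dl), (r, dr)). (Node l () r, glue m l r dl dr)"], goal_cases)
    case (1 a)
    then obtain j l dl r dr where a: "a = (j, (l, dl), (r, dr))" "j \<in> J"
        "dl \<in> labelings l (lefts S c j) c" "dr \<in> labelings r (rights S c j) (\<lambda>p. c p - j)"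
      by (auto simp: labeled_trees_def)
    have "j = int (size l) + 1" "n = int (size l + size r + 1)"
      using a(2) card[of j] card_labelings(1)[OF a(3)] card_labelings(1)[OF a(4)] by (auto simp: J_def n_def)
    then show ?case
      using labelings_NodeI(2,3)[OF S _ _ _ a(3,4)] a by (simp add: J_def m_def)
  next
    case (2 a)
    then obtain j l dl r dr where a: "a = (j, (l, dl), (r, dr))" "j \<in> J"
        "dl \<in> labelings l (lefts S c j) c" "dr \<in> labelings r (rights S c j) (\<lambda>p. c p - j)"
      by (auto simp: labeled_trees_def)
    have "j = int (size l) + 1" "n = int (size l + size r + 1)"
      using a(2) card[of j] card_labelings(1)[OF a(3)] card_labelings(1)[OF a(4)] by (auto simp: J_def n_def)
    then show ?case
      using labelings_NodeI(1)[OF S _ _ _ a(3,4)] a by (simp add: J_def m_def labeled_trees_def)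
  next
    case (3 b)
    then obtain T dec where b: "b = (T, dec)" "dec \<in> labelings T S c"
      by (auto simp: labeled_trees_def)
    obtain l r where T: "T = Node l () r"
      using card_labelings(1)[OF b(2)] S by (cases T) auto
    show ?case
      using labelings_NodeD(5)[OF b(2)[unfolded T]] b by (simp add: T m_def)
  next
    case (4 b)
    then obtain T dec where b: "b = (T, dec)" "dec \<in> labelings T S c"
      by (auto simp: labeled_trees_def)
    obtain l r where T: "T = Node l () r"
      using card_labelings(1)[OF b(2)] S by (cases T) auto
    have n: "n = int (size l + size r + 1)"
      using card_labelings(1)[OF b(2)] by (simp add: n_def T)
    note D = labelings_NodeD[OF b(2)[unfolded T]]
    show ?case
      using D(1-4) card_labelings(1)[OF D(3)] b by (simp add: T J_def labeled_trees_def n m_def)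
  next
    case (5 a)
    then obtain j l dl r dr where a: "a = (j, (l, dl), (r, dr))" "j \<in> J"
        "dl \<in> labelings l (lefts S c j) c" "dr \<in> labelings r (rights S c j) (\<lambda>p. c p - j)"
      by (auto simp: labeled_trees_def)
    have j: "j = int (size l) + 1" and n: "n = int (size l + size r + 1)"
      using a(2) card[of j] card_labelings(1)[OF a(3)] card_labelings(1)[OF a(4)] by (auto simp: J_def n_def)
    have "wt (Node l () r) (c \<circ> glue m l r dl dr) =
        wtq 1 n j (c m) * (wt l (c \<circ> dl) * wt r ((\<lambda>p. c p - j) \<circ> dr))"
      unfolding wt_Node n j by (simp add: glue_def wt_def)
    then show ?case by (simp add: a(1))
  qed
  also have "\<dots> = (\<Sum>j\<in>J. \<Sum>((l, dl), (r, dr))\<in>?L j \<times> ?R j.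
      wtq 1 n j (c m) * (wt l (c \<circ> dl) * wt r ((\<lambda>p. c p - j) \<circ> dr)))"
    using finJ by (subst sum.Sigma) (auto simp: finite_labeled_trees intro!: sum.cong)
  also have "\<dots> = (\<Sum>j\<in>J. wtq 1 n j (c m) * (tree_sum (lefts S c j) c * tree_sum (rights S c j) (\<lambda>p. c p - j)))"
    unfolding prod sum_distrib_left by (simp add: case_prod_beta)
  also have "\<dots> = (\<Sum>j\<in>{1..n}. if c m \<in> {1..n} \<and> j \<notin> c ` (S - {m}) \<and> int (card (lefts S c j)) = j - 1
    then wtq 1 n j (c m) * (tree_sum (lefts S c j) c * tree_sum (rights S c j) (\<lambda>p. c p - j)) else 0)"
    unfolding J_def by (rule sum.inter_filter) simp
  finally show ?thesis .
qed

lemma filter_sorted_list_of_set: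
  "finite S \<Longrightarrow> filter P (sorted_list_of_set S) = sorted_list_of_set {p \<in> S. P p}"
  by (rule sorted_distinct_set_unique) (auto simp: sorted_filter[where f = id, simplified])

lemma sorted_list_of_set_Max:
  fixes S :: "nat set"
  assumes "finite S" "S \<noteq> {}"
  shows "sorted_list_of_set S = sorted_list_of_set (S - {Max S}) @ [Max S]"
proof (rule sorted_distinct_set_unique)
  show "set (sorted_list_of_set S) = set (sorted_list_of_set (S - {Max S}) @ [Max S])"
    using assms by (simp add: insert_absorb)
qed (use assms in \<open>simp_all add: sorted_append\<close>)

text \<open>Both sides satisfy the same recursion. When the number of letters below \<open>j\<close> is not \<open>j - 1\<close>, there
  is no tree with root label \<open>j\<close>, and the interval below \<open>j\<close> cannot be filled exactly.\<close>

lemma tree_sum_eq_fill: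
  assumes "finite S"
  shows "tree_sum S c = fill (map c (rev (sorted_list_of_set S))) {1..int (card S)}"
  using assms
proof (induction "card S" arbitrary: S c rule: less_induct)
  case less
  show ?case
  proof (cases "S = {}")
    case True
    then show ?thesis by (simp add: tree_sum_empty)
  next
    case False': False
    let ?m = "Max S" and ?n = "int (card S)"
    let ?w = "map c (rev (sorted_list_of_set (S - {?m})))"
    have m: "?m \<in> S" using less(2) False' by simp
    \<comment> \<open>The largest position holds the last letter, which is the head of the reversed word.\<close>
    have w: "map c (rev (sorted_list_of_set S)) = c ?m # ?w"
      by (subst sorted_list_of_set_Max[OF less(2) False']) simp
    have summand: "(if c ?m \<in> {1..?n} \<and> j \<notin> c ` (S - {?m}) \<and> int (card (lefts S c j)) = j - 1
        then wtq 1 ?n j (c ?m) * (tree_sum (lefts S c j) c * tree_sum (rights S c j) (\<lambda>p. c p - j)) else 0) =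
      (if c ?m \<in> {1..?n} \<and> j \<notin> set ?w then wtq 1 ?n j (c ?m) *
        (fill (filter (\<lambda>x. x < j) ?w) {1..j-1} *
        fill (map (\<lambda>x. x - j) (filter (\<lambda>x. j < x) ?w)) {1..?n-j}) else 0)"
      if "j \<in> {1..?n}" for j
    proof (cases "c ?m \<in> {1..?n} \<and> j \<notin> c ` (S - {?m})")
      case cond: True
      have fin: "finite (lefts S c j)" "finite (rights S c j)"
        using less(2) by (auto simp: lefts_def rights_def)
      have sub: "lefts S c j \<subseteq> S - {?m}" "rights S c j \<subseteq> S - {?m}"
        by (auto simp: lefts_def rights_def)
      have card1: "card (S - {?m}) < card S" using less(2) m by (rule card_Diff1_less)
      have cards: "card (lefts S c j) < card S" "card (rights S c j) < card S"
        using sub card_mono[OF _ sub(1)] card_mono[OF _ sub(2)] card1 less(2) by auto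
      have l: "filter (\<lambda>x. x < j) ?w = map c (rev (sorted_list_of_set (lefts S c j)))"
        using less(2) by (simp add: filter_map comp_def lefts_def filter_sorted_list_of_set flip: rev_filter)
      have r: "map (\<lambda>x. x - j) (filter (\<lambda>x. j < x) ?w) =
          map (\<lambda>p. c p - j) (rev (sorted_list_of_set (rights S c j)))"
        using less(2) by (simp add: filter_map comp_def rights_def filter_sorted_list_of_set flip: rev_filter)
      have setw: "set ?w = c ` (S - {?m})" using less(2) by simp
      show ?thesis
      proof (cases "int (card (lefts S c j)) = j - 1")
        case True
        have "int (card (rights S c j)) = ?n - j"
          using True card_lefts_rights[OF less(2) False', of j c] cond by auto
        then show ?thesis
          using cond True less(1)[OF cards(1) fin(1)] less(1)[OF cards(2) fin(2)]
          unfolding l r setw by simp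
      next
        case False
        have "card {1..j-1} \<noteq> length (map c (rev (sorted_list_of_set (lefts S c j))))"
          using False that by (simp add: nat_eq_iff)
        then have "fill (map c (rev (sorted_list_of_set (lefts S c j)))) {1..j-1} = 0"
          by (intro fill_card) auto
        then show ?thesis using cond False unfolding l r setw by simp
      qed
    next
      case False
      then show ?thesis using less(2) by auto
    qed
    show ?thesis
      unfolding w fill_interval_Cons tree_sum_rec[OF less(2) False']
      by (rule sum.cong[OF refl summand])
  qed
qed

lemma sum_compatible_trees:
  "(\<Sum>T\<in>compatible_trees w. wt_word T w) = fill (rev (map int w)) {1..int (length w)}"
proof -
  define c where "c = (\<lambda>p. int (w ! (p - 1)))"
  let ?S = "{1..length w}"
  have lab: "compatible_labeling w T dec \<longleftrightarrow> dec \<in> labelings T ?S c" if "size T = length w" for T :: "unit tree" and dec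
    unfolding compatible_labeling_def decreasing_def labelings_def word_coloring_def that c_def comp_def
    by auto
  have THE_lab: "(THE dec. compatible_labeling w T dec) = dec"
    if "dec \<in> labelings T ?S c" for T :: "unit tree" and dec
    using lab[of T] card_labelings(1)[OF that] that labelings_unique by (intro the_equality) auto
  have "(\<Sum>T\<in>compatible_trees w. wt_word T w) = tree_sum ?S c"
    unfolding tree_sum_def
  proof (rule sum.reindex_bij_witness[where i = fst and
      j = "\<lambda>T. (T, THE dec. compatible_labeling w T dec)"], goal_cases)
    case (2 T)
    then obtain dec where "dec \<in> labelings T ?S c"
      using lab by (auto simp: compatible_trees_def)
    then show ?case using THE_lab by (simp add: labeled_trees_def)
  next
    case (3 p)
    then show ?case using THE_lab by (auto simp: labeled_trees_def)
  next
    case (4 p)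
    then obtain T dec where "p = (T, dec)" "dec \<in> labelings T ?S c"
      by (auto simp: labeled_trees_def)
    then show ?case
      using lab[of T] card_labelings(1)[of dec T ?S c] by (auto simp: compatible_trees_def)
  next
    case (5 T)
    have "word_coloring w dec = c \<circ> dec" for dec
      by (rule ext) (simp add: word_coloring_def c_def)
    then show ?case by (simp add: wt_word_def)
  qed simp
  also have "\<dots> = fill (map c (rev (sorted_list_of_set ?S))) {1..int (length w)}"
    by (simp add: tree_sum_eq_fill)
  also have "map c (rev (sorted_list_of_set ?S)) = rev (map int w)"
  proof -
    have "sorted_list_of_set ?S = [1..<length w + 1]"
      by (metis Suc_eq_plus1 atLeastLessThanSuc_atLeastAtMost sorted_list_of_set_range)
    moreover have "map c [1..<length w + 1] = map int w"
      by (rule nth_equalityI) (simp_all add: c_def del: upt_Suc)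
    ultimately show ?thesis
      by (simp only: rev_map[symmetric])
  qed
  finally show ?thesis .
qed

theorem theorem3p5:
  fixes r :: nat and c w :: "nat list"
  assumes "r \<ge> 1"
    and "c \<in> W r"
    and "w \<in> words r"
    and "cont w = c"
  shows "to_fract (A c) = (\<Sum>T\<in>compatible_trees w. qfact r * wt_word T w)"
proof -
  have w: "length w = r" "set w \<subseteq> {1..r}"
    using assms(3) by (auto simp: words_def)
  interpret klyachko r "\<lambda>M. A_mset r (image_mset nat M)"
  proof
    fix M :: "int multiset"
    assume "\<not> set_mset M \<subseteq> {1..int r}"
    then obtain x where "x \<in># M" "x \<notin> {1..int r}" by blast
    then have "nat x \<in># image_mset nat M" "nat x \<notin> {1..r}" by auto
    then show "A_mset r (image_mset nat M) = 0"
      unfolding A_mset_def by (meson subsetD)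
  next
    fix i and M :: "int multiset"
    assume *: "i \<in> {1..int r}" "set_mset M \<subseteq> {1..int r}" "size M + 2 = r"
    have "nat i \<in> {1..r}" "set_mset (image_mset nat M) \<subseteq> {1..r}" "size (image_mset nat M) + 2 = r"
      using * by (auto dest!: subsetD)
    from A_mset_relation[OF this]
    show "(1 + q) * A_mset r (image_mset nat (add_mset i (add_mset i M))) =
        q * A_mset r (image_mset nat (add_mset i (add_mset (i - 1) M))) +
        A_mset r (image_mset nat (add_mset i (add_mset (i + 1) M)))"
      using * by (simp add: nat_diff_distrib nat_add_distrib)
  qed
  have "count (mset w) = count_list w"
    by (rule ext) (rule count_mset)
  then have "map (count (mset w)) [1..<r+1] = c"
    using assms(4) w(1) by (simp add: cont_def del: upt_Suc)
  then have "to_fract (A c) = A_mset r (mset w)"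
    using w(2) by (simp add: A_mset_def)
  also have "mset w = image_mset nat (mset (rev (map int w)))"
    by (simp add: multiset.map_comp comp_def)
  also have "A_mset r \<dots> = qfact r * fill (rev (map int w)) {1..int r} * A_mset r (image_mset nat (replicate_mset r 1))"
    by (rule eq_qfact_fill) (use w assms(1) in auto)
  also have "A_mset r (image_mset nat (replicate_mset r 1)) = 1"
    using A_mset_replicate[OF assms(1)] by simp
  finally show ?thesis
    using sum_compatible_trees[of w] w(1) by (simp flip: sum_distrib_left)
qed

end
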